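(* Let $\mathbb{V}$ be the set of bounded real-valued potentials $v$ on $\mathbb{N}$ and consider the problem function $$\widehat{\Xi}:\mathbb{V}\times\mathbb{N}\to\mathbb{R}_{\ge0},\qquad(v,j)\mapsto\langle E^{H_v}_{\{1\}}e_j,e_j\rangle .$$ Then $\{\widehat{\Xi},\mathbb{V}\times\mathbb{N},\Lambda_3\}\in\Delta_2^A$ but $\{\widehat{\Xi},\mathbb{V}\times\mathbb{N},\Lambda_3\}\notin\Delta_1^G$. In other words, $\widehat{\Xi}$ can be computed in one limit, but it cannot be computed with error control.
   Context: $H_0$ is the bounded operator on $l^2(\mathbb{N})$ whose matrix in the canonical basis $\{e_n\}_{n\in\mathbb{N}}$ is tridiagonal with $2$ on the diagonal and $-1$ on the sub- and super-diagonals. $H_v=H_0+v$, where $v$ acts as multiplication by $\mathrm{diag}(v(1),v(2),\dots)$. $E^{H_v}$ is the projection-valued spectral measure of $H_v$ and $E^{H_v}_{\{1\}}=E^{H_v}(\{1\})$. $\Lambda_3$ consists of the pointwise evaluations $v\mapsto v(n)$, $n\in\mathbb{N}$ (together with the input index $j$). $\mathbb{R}_{\ge0}$ has the usual metric. **Computational problems.** A computational problem $\{\Xi,\Omega,\mathcal{M},\Lambda\}$ (written $\{\Xi,\Omega,\Lambda\}$ when $\mathcal{M}$ is clear) consists of a set $\Omega$, a metric space $(\mathcal{M},d)$, a map $\Xi:\Omega\to\mathcal{M}$ and a set $\Lambda$ of complex-valued functions on $\Omega$ (the information that may be read). A general algorithm is a map $\Gamma:\Omega\to\mathcal{M}$ such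 that for every $A\in\Omega$ there is a finite non-empty $\Lambda_\Gamma(A)\subset\Lambda$ for which $\Gamma(A)$ depends only on $\{g(A)\}_{g\in\Lambda_\Gamma(A)}$, and $\Lambda_\Gamma(B)=\Lambda_\Gamma(A)$ whenever $g(B)=g(A)$ for all $g\in\Lambda_\Gamma(A)$. A sequence of general algorithms $\Gamma_n$ is a sequence of arithmetic algorithms if, for each $A$, $n\mapsto\Gamma_n(A)$ is recursive (executable by a Turing machine with oracle access to the values $g(A)$ if these are rational, and by a Blum--Shub--Smale machine with such an oracle if they are real or complex), only finitely many arithmetic operations and comparisons on $\{g(A)\}_{g\in\Lambda_{\Gamma_n}(A)}$ are used, and the output is a finite string of complex numbers identified with an element of $\mathcal{M}$. $\{\Xi,\Omega,\Lambda\}\in\Delta_2^A$ means that there is a sequence of arithmetic algorithms with $\lim_{n\to\infty}\Gamma_n(A)=\Xi(A)$ for all $A\in\Omega$. $\{\Xi,\Omega,\Lambda\}\in\Delta_1^G$ means that there is a sequence of general algorithms with $d(\Gamma_n(A),\Xi(A))\le2^{-n}$ for all $A\in\Omega$ and $n\in\mathbb{N}$. *)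

theory Defs
  imports "HOL-Analysis.Analysis"
begin

section \<open>The Hilbert space of square-summable sequences\<close>

text \<open>Positions are counted from 0: index \<open>k\<close> of type \<^typ>\<open>nat\<close> stands for the basis vector
  number \<open>k + 1\<close> if one lets the positive integers index the canonical basis. Operators are
  functions on all sequences, of which only the restriction to \<open>ell2\<close> matters.\<close>

definition ell2 :: "(nat \<Rightarrow> complex) set" where
  "ell2 = {x. summable (\<lambda>n. (norm (x n))\<^sup>2)}"

definition ell2_inner :: "(nat \<Rightarrow> complex) \<Rightarrow> (nat \<Rightarrow> complex) \<Rightarrow> complex" where
  "ell2_inner x y = (\<Sum>n. x n * cnj (y n))"

definition ell2_norm :: "(nat \<Rightarrow> complex) \<Rightarrow> real" where
  "ell2_norm x = sqrt (\<Sum>n. (norm (x n))\<^sup>2)"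

definition unit_vec :: "nat \<Rightarrow> nat \<Rightarrow> complex" where
  "unit_vec j = (\<lambda>n. if n = j then 1 else 0)"

definition bounded_operator :: "((nat \<Rightarrow> complex) \<Rightarrow> (nat \<Rightarrow> complex)) \<Rightarrow> bool" where
  "bounded_operator T \<longleftrightarrow>
     (\<forall>x\<in>ell2. T x \<in> ell2) \<and>
     (\<forall>x\<in>ell2. \<forall>y\<in>ell2. T (\<lambda>n. x n + y n) = (\<lambda>n. T x n + T y n)) \<and>
     (\<forall>c. \<forall>x\<in>ell2. T (\<lambda>n. c * x n) = (\<lambda>n. c * T x n)) \<and>
     (\<exists>K. \<forall>x\<in>ell2. ell2_norm (T x) \<le> K * ell2_norm x)"

definition orthogonal_projection :: "((nat \<Rightarrow> complex) \<Rightarrow> (nat \<Rightarrow> complex)) \<Rightarrow> bool" where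
  "orthogonal_projection P \<longleftrightarrow>
     bounded_operator P \<and>
     (\<forall>x\<in>ell2. P (P x) = P x) \<and>
     (\<forall>x\<in>ell2. \<forall>y\<in>ell2. ell2_inner (P x) y = ell2_inner x (P y))"

section \<open>Projection-valued measures and the spectral measure of an operator\<close>

definition projection_valued_measure ::
    "(real set \<Rightarrow> (nat \<Rightarrow> complex) \<Rightarrow> (nat \<Rightarrow> complex)) \<Rightarrow> bool" where
  "projection_valued_measure E \<longleftrightarrow>
     (\<forall>S\<in>sets borel. orthogonal_projection (E S)) \<and>
     (\<forall>x\<in>ell2. E {} x = (\<lambda>n. 0)) \<and>
     (\<forall>x\<in>ell2. E UNIV x = x) \<and>
     (\<forall>S\<in>sets borel. \<forall>T\<in>sets borel. \<forall>x\<in>ell2. E (S \<inter> T) x = E S (E T x)) \<and>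
     (\<forall>S::nat \<Rightarrow> real set. range S \<subseteq> sets borel \<longrightarrow> disjoint_family S \<longrightarrow>
        (\<forall>x\<in>ell2.
           (\<lambda>N. ell2_norm (\<lambda>n. E (\<Union>i. S i) x n - (\<Sum>i<N. E (S i) x n))) \<longlonglongrightarrow> 0))"

definition scalar_measure ::
    "(real set \<Rightarrow> (nat \<Rightarrow> complex) \<Rightarrow> (nat \<Rightarrow> complex)) \<Rightarrow> (nat \<Rightarrow> complex) \<Rightarrow> real measure" where
  "scalar_measure E x =
     measure_of UNIV (sets borel) (\<lambda>S. ennreal (Re (ell2_inner (E S x) x)))"

text \<open>\<open>T\<close> is the integral of \<open>\<lambda>\<close> against \<open>E\<close> in the weak sense. By polarization it suffices to
  demand this for the quadratic forms. A bounded operator has bounded spectrum, hence the bounded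
  support, which makes all the integrals converge.\<close>

definition is_spectral_measure ::
    "((nat \<Rightarrow> complex) \<Rightarrow> (nat \<Rightarrow> complex)) \<Rightarrow>
     (real set \<Rightarrow> (nat \<Rightarrow> complex) \<Rightarrow> (nat \<Rightarrow> complex)) \<Rightarrow> bool" where
  "is_spectral_measure T E \<longleftrightarrow>
     projection_valued_measure E \<and>
     (\<exists>a. \<forall>x\<in>ell2. E {-a..a} x = x) \<and>
     (\<forall>x\<in>ell2. ell2_inner (T x) x = complex_of_real (LINT t|scalar_measure E x. t))"

text \<open>For bounded self-adjoint \<open>T\<close> the spectral theorem gives existence, and uniqueness on Borel sets
  and square-summable sequences. Only the irrelevant values elsewhere are left open, which is why
  the definite description operator cannot be used.\<close>

definition spectral_measure ::
    "((nat \<Rightarrow> complex) \<Rightarrow> (nat \<Rightarrow> complex)) \<Rightarrow>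
     real set \<Rightarrow> (nat \<Rightarrow> complex) \<Rightarrow> (nat \<Rightarrow> complex)" where
  "spectral_measure T = (SOME E. is_spectral_measure T E)"

section \<open>The discrete Schroedinger operators and the problem function\<close>

definition H0 :: "(nat \<Rightarrow> complex) \<Rightarrow> (nat \<Rightarrow> complex)" where
  "H0 x = (\<lambda>n. 2 * x n - x (Suc n) - (if n = 0 then 0 else x (n - 1)))"

definition Hv :: "(nat \<Rightarrow> real) \<Rightarrow> (nat \<Rightarrow> complex) \<Rightarrow> (nat \<Rightarrow> complex)" where
  "Hv v x = (\<lambda>n. H0 x n + complex_of_real (v n) * x n)"

definition bounded_potentials :: "(nat \<Rightarrow> real) set" where
  "bounded_potentials = {v. bounded (range v)}"

text \<open>The inner product is real, as \<open>E\<close> takes values in the orthogonal projections.\<close>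

definition Xi_hat :: "(nat \<Rightarrow> real) \<times> nat \<Rightarrow> real" where
  "Xi_hat = (\<lambda>(v, j).
     Re (ell2_inner (spectral_measure (Hv v) {1} (unit_vec j)) (unit_vec j)))"

definition Lambda3 :: "((nat \<Rightarrow> real) \<times> nat \<Rightarrow> complex) set" where
  "Lambda3 = {\<lambda>(v, j). complex_of_real (v n) | n. True} \<union> {\<lambda>(v, j). of_nat j}"

text \<open>The numbering through which a machine addresses the elements of \<open>Lambda3\<close>.\<close>

fun eval3 :: "nat \<Rightarrow> (nat \<Rightarrow> real) \<times> nat \<Rightarrow> complex" where
  "eval3 0 = (\<lambda>(v, j). of_nat j)"
| "eval3 (Suc n) = (\<lambda>(v, j). complex_of_real (v n))"

lemma range_eval3: "range eval3 = Lambda3"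
proof
  show "range eval3 \<subseteq> Lambda3"
  proof
    fix g assume "g \<in> range eval3"
    then obtain k where "g = eval3 k" by blast
    then show "g \<in> Lambda3" by (cases k) (auto simp: Lambda3_def)
  qed
  have "(\<lambda>(v, j). of_nat j) \<in> range eval3"
    using rangeI[of eval3 0] by simp
  moreover have "(\<lambda>(v, j). complex_of_real (v n)) \<in> range eval3" for n
    using rangeI[of eval3 "Suc n"] by simp
  ultimately show "Lambda3 \<subseteq> range eval3"
    unfolding Lambda3_def by blast
qed

section \<open>General algorithms\<close>

text \<open>\<open>L A\<close> is the finite set of information that the algorithm uses on input \<open>A\<close>.\<close>

definition general_algorithm_with ::
    "'a set \<Rightarrow> 'm set \<Rightarrow> ('a \<Rightarrow> complex) set \<Rightarrow> ('a \<Rightarrow> ('a \<Rightarrow> complex) set) \<Rightarrow> ('a \<Rightarrow> 'm) \<Rightarrow> bool" where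
  "general_algorithm_with \<Omega> M \<Lambda> L \<Gamma> \<longleftrightarrow>
     (\<forall>A\<in>\<Omega>. \<Gamma> A \<in> M \<and> finite (L A) \<and> L A \<noteq> {} \<and> L A \<subseteq> \<Lambda> \<and>
        (\<forall>B\<in>\<Omega>. (\<forall>g\<in>L A. g B = g A) \<longrightarrow> \<Gamma> B = \<Gamma> A \<and> L B = L A))"

definition general_algorithm ::
    "'a set \<Rightarrow> 'm set \<Rightarrow> ('a \<Rightarrow> complex) set \<Rightarrow> ('a \<Rightarrow> 'm) \<Rightarrow> bool" where
  "general_algorithm \<Omega> M \<Lambda> \<Gamma> \<longleftrightarrow> (\<exists>L. general_algorithm_with \<Omega> M \<Lambda> L \<Gamma>)"

definition in_Delta1G ::
    "('a \<Rightarrow> 'm::metric_space) \<Rightarrow> 'a set \<Rightarrow> 'm set \<Rightarrow> ('a \<Rightarrow> complex) set \<Rightarrow> bool" where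
  "in_Delta1G \<Xi> \<Omega> M \<Lambda> \<longleftrightarrow>
     (\<exists>\<Gamma>. (\<forall>n::nat. general_algorithm \<Omega> M \<Lambda> (\<Gamma> n)) \<and>
          (\<forall>n. \<forall>A\<in>\<Omega>. dist (\<Gamma> n A) (\<Xi> A) \<le> (1/2) ^ n))"

section \<open>Oracle Blum--Shub--Smale machines\<close>

text \<open>
  The machines of Blum, Shub and Smale: a finite list of instructions acts on a sequence
  \<open>x\<close> of registers and on two address registers \<open>r\<close>, \<open>w\<close>, which can only be reset or incremented and
  serve the copy instruction \<open>x w := x r\<close>. There are two additions.

  \<^item> A query replaces the number \<open>k\<close> in a register by the \<open>k\<close>-th oracle value. It is stuck
    if the register does not contain a natural number.

  \<^item> A register holds a complex number, to be thought of as a pair of real registers. Correspondingly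
    real and imaginary parts are available, and comparisons concern real parts.

  The constants are Gaussian rationals, so that on a rational oracle every register
  content is rational and the machine is a Turing machine with that oracle. Thus one and the same
  program meets the requirements for rational and for real or complex information. The
  convention \<open>z / 0 = 0\<close> adds nothing, as a zero denominator can be tested for.\<close>

datatype rat_expr =
    Reg nat
  | Const rat rat
  | Add rat_expr rat_expr
  | Sub rat_expr rat_expr
  | Mul rat_expr rat_expr
  | Div rat_expr rat_expr
  | RePart rat_expr
  | ImPart rat_expr

primrec expr_val :: "(nat \<Rightarrow> complex) \<Rightarrow> rat_expr \<Rightarrow> complex" where
  "expr_val x (Reg i) = x i"
| "expr_val x (Const p q) = Complex (of_rat p) (of_rat q)"
| "expr_val x (Add a b) = expr_val x a + expr_val x b"
| "expr_val x (Sub a b) = expr_val x a - expr_val x b"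
| "expr_val x (Mul a b) = expr_val x a * expr_val x b"
| "expr_val x (Div a b) = expr_val x a / expr_val x b"
| "expr_val x (RePart a) = complex_of_real (Re (expr_val x a))"
| "expr_val x (ImPart a) = complex_of_real (Im (expr_val x a))"

datatype bss_instr =
    Assign nat rat_expr
  | Branch nat nat
  | Query nat
  | ResetR | IncR | ResetW | IncW
  | Copy

text \<open>The last component records the numbers of the oracle values read so far.\<close>

datatype bss_config =
  Config (pc: nat) (rd: nat) (wr: nat) (regs: "nat \<Rightarrow> complex") (queried: "nat set")

inductive bss_step ::
    "bss_instr list \<Rightarrow> (nat \<Rightarrow> complex) \<Rightarrow> bss_config \<Rightarrow> bss_config \<Rightarrow> bool"
  for P :: "bss_instr list" and orc :: "nat \<Rightarrow> complex" where
  assign: "\<lbrakk>p < length P; P ! p = Assign i e\<rbrakk> \<Longrightarrow>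
     bss_step P orc (Config p r w x Q) (Config (Suc p) r w (x(i := expr_val x e)) Q)"
| branch: "\<lbrakk>p < length P; P ! p = Branch i l\<rbrakk> \<Longrightarrow>
     bss_step P orc (Config p r w x Q) (Config (if Re (x i) \<ge> 0 then l else Suc p) r w x Q)"
| query: "\<lbrakk>p < length P; P ! p = Query i; x i = of_nat k\<rbrakk> \<Longrightarrow>
     bss_step P orc (Config p r w x Q) (Config (Suc p) r w (x(i := orc k)) (insert k Q))"
| reset_r: "\<lbrakk>p < length P; P ! p = ResetR\<rbrakk> \<Longrightarrow>
     bss_step P orc (Config p r w x Q) (Config (Suc p) 0 w x Q)"
| inc_r: "\<lbrakk>p < length P; P ! p = IncR\<rbrakk> \<Longrightarrow>
     bss_step P orc (Config p r w x Q) (Config (Suc p) (Suc r) w x Q)"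
| reset_w: "\<lbrakk>p < length P; P ! p = ResetW\<rbrakk> \<Longrightarrow>
     bss_step P orc (Config p r w x Q) (Config (Suc p) r 0 x Q)"
| inc_w: "\<lbrakk>p < length P; P ! p = IncW\<rbrakk> \<Longrightarrow>
     bss_step P orc (Config p r w x Q) (Config (Suc p) r (Suc w) x Q)"
| copy: "\<lbrakk>p < length P; P ! p = Copy\<rbrakk> \<Longrightarrow>
     bss_step P orc (Config p r w x Q) (Config (Suc p) r w (x(w := x r)) Q)"

text \<open>Input \<open>n\<close> is given in register 0. On halting (program counter just behind the program),
  register 0 contains the length of the output string and the following registers contain its
  entries. \<open>K\<close> is the set of the numbers of all oracle values that are read.\<close>

definition bss_computes ::
    "bss_instr list \<Rightarrow> (nat \<Rightarrow> complex) \<Rightarrow> nat \<Rightarrow> complex list \<Rightarrow> nat set \<Rightarrow> bool" where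
  "bss_computes P orc n out K \<longleftrightarrow>
     (\<exists>r w x.
        (bss_step P orc)\<^sup>*\<^sup>* (Config 0 0 0 ((\<lambda>_. 0)(0 := of_nat n)) {}) (Config (length P) r w x K) \<and>
        x 0 = of_nat (length out) \<and>
        (\<forall>i<length out. x (Suc i) = out ! i))"

section \<open>Arithmetic algorithms\<close>

text \<open>\<open>g\<close> is the numbering of \<open>\<Lambda>\<close> used by the oracle, and \<open>enc\<close> identifies points of \<open>M\<close> with
  strings of complex numbers. A single program serves all \<open>A\<close> and \<open>n\<close>. Since a halting run is finite,
  it performs finitely many arithmetic operations and comparisons.\<close>

definition arithmetic_algorithms ::
    "'a set \<Rightarrow> 'm set \<Rightarrow> (nat \<Rightarrow> 'a \<Rightarrow> complex) \<Rightarrow> ('m \<Rightarrow> complex list) \<Rightarrow> (nat \<Rightarrow> 'a \<Rightarrow> 'm) \<Rightarrow> bool" where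
  "arithmetic_algorithms \<Omega> M g enc \<Gamma> \<longleftrightarrow>
     (\<exists>L P.
        (\<forall>n. general_algorithm_with \<Omega> M (range g) (L n) (\<Gamma> n)) \<and>
        (\<forall>n. \<forall>A\<in>\<Omega>. \<exists>K. bss_computes P (\<lambda>k. g k A) n (enc (\<Gamma> n A)) K \<and> g ` K \<subseteq> L n A))"

definition in_Delta2A ::
    "('a \<Rightarrow> 'm::metric_space) \<Rightarrow> 'a set \<Rightarrow> 'm set \<Rightarrow> ('a \<Rightarrow> complex) set \<Rightarrow>
     (nat \<Rightarrow> 'a \<Rightarrow> complex) \<Rightarrow> ('m \<Rightarrow> complex list) \<Rightarrow> bool" where
  "in_Delta2A \<Xi> \<Omega> M \<Lambda> g enc \<longleftrightarrow>
     range g = \<Lambda> \<and> inj_on enc M \<and>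
     (\<exists>\<Gamma>. arithmetic_algorithms \<Omega> M g enc \<Gamma> \<and> (\<forall>A\<in>\<Omega>. (\<lambda>n. \<Gamma> n A) \<longlonglongrightarrow> \<Xi> A))"

end

theory Submission
  imports Defs "HOL-Probability.Helly_Selection" "HOL-Probability.Probability_Mass_Function"
begin

text \<open>Let \<open>u\<close> be the solution of \<open>H\<^sub>v u = u\<close> with first entry 1. The equation is a three-term recursion, so it determines
\<open>u\<close> (\<open>eigensequence\<close>), and the eigenspace of \<open>H\<^sub>v\<close> at 1 is spanned by \<open>u\<close> if \<open>u\<close> is square summable and is trivial
otherwise. As \<open>E({1})\<close> is the orthogonal projection onto this eigenspace, the quantity to be computed is
\<open>u(j)\<^sup>2 / (\<Sum>k. u(k)\<^sup>2)\<close>, read as 0 if the series diverges (\<open>Xi_hat_square_summable\<close>,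
\<open>Xi_hat_not_square_summable\<close>).

In both cases it is the limit of the quotients \<open>u(j)\<^sup>2 / (\<Sum>k\<le>n. u(k)\<^sup>2)\<close> with \<open>n \<ge> j\<close>, which a machine
obtains from finitely many values of \<open>v\<close> by rational operations: this is the computation in one limit. Error
control is impossible because square summability of \<open>u\<close> is decided at infinity. For
\<open>v = (-1/2, 3/2, 3/2, \<dots>)\<close> one has \<open>u(n) = 2\<^sup>-\<^sup>n\<close>, with value \<open>3/4\<close> at the first basis vector. If \<open>v\<close> is replaced
by 0 from some position on, then \<open>u\<close> oscillates without decay from there on and the value drops to 0; an algorithm
that has read only earlier entries cannot notice this.

The spectral measure is chosen among all spectral measures of \<open>H\<^sub>v\<close>, so two facts from spectral theory carry the
formula above.

\<^item> A spectral measure exists (\<open>spectral_measure_affine\<close>). Rescale \<open>H\<^sub>v\<close> to an operator \<open>A\<close> with \<open>0 \<le> A \<le> 1\<close>. For every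
  \<open>x\<close> the numbers \<open>\<langle>A\<^sup>i (1 - A)\<^sup>m x, x\<rangle>\<close> are nonnegative, and by Hausdorff's theorem the \<open>\<langle>A\<^sup>k x, x\<rangle>\<close> are the
  moments of a measure on \<open>[0,1]\<close>. Polarization turns these measures into a form-valued integral of bounded Borel
  functions. Its linearity, symmetry and multiplicativity are identities between functionals that are continuous
  under bounded convergence, and such a functional is determined on Borel sets by its moments
  (\<open>sigma_functional_determined_by_moments\<close>). So every identity has to be checked for powers of \<open>A\<close> only.

\<^item> In every spectral measure the projection of a point is the projection onto the eigenspace
  (\<open>E_point_is_eigenvector\<close>, \<open>E_point_fixes_eigenvector\<close>). The reason is that \<open>H\<^sub>v\<close> maps the range
  of each \<open>E(S)\<close> into the orthogonal complement of the kernel of \<open>E(S)\<close> (\<open>T_orthogonal\<close>). So the part of an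
  eigenvector in the range of \<open>E(S)\<close> still has 1 as the mean value of its scalar measure, and this excludes the parts
  strictly above and strictly below 1.\<close>

section \<open>The Hausdorff moment problem\<close>

text \<open>The binomial theorem for \<open>(a + b)\<^sup>m = 1\<close>, with \<open>w i m\<close> in the role of \<open>a\<^sup>i b\<^sup>m\<close>: the recursion expresses
\<open>a + b = 1\<close>.\<close>

lemma binomial_difference_sum:
  fixes w :: "nat \<Rightarrow> nat \<Rightarrow> real"
  assumes rec: "\<And>i m. w i m = w (Suc i) m + w i (Suc m)"
  shows "(\<Sum>i\<le>m. real (m choose i) * w (k + i) (m - i)) = w k 0"
proof (induction m)
  case 0 then show ?case by simp
next
  case (Suc m)
  have "(\<Sum>i\<le>Suc m. real (Suc m choose i) * w (k + i) (Suc m - i)) =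
     w k (Suc m) + (\<Sum>i\<le>m. (real (m choose Suc i) + real (m choose i)) * w (k + Suc i) (m - i))"
    by (subst sum.atMost_Suc_shift) (simp add: add.commute)
  also have "\<dots> = (w k (Suc m) + (\<Sum>i\<le>m. real (m choose Suc i) * w (k + Suc i) (m - i)))
      + (\<Sum>i\<le>m. real (m choose i) * w (k + Suc i) (m - i))"
    by (simp add: sum.distrib distrib_right)
  also have "w k (Suc m) + (\<Sum>i\<le>m. real (m choose Suc i) * w (k + Suc i) (m - i)) =
     (\<Sum>i\<le>Suc m. real (m choose i) * w (k + i) (Suc m - i))"
    by (subst sum.atMost_Suc_shift) simp
  also have "\<dots> = (\<Sum>i\<le>m. real (m choose i) * w (k + i) (Suc (m - i)))"
    by (simp add: Suc_diff_le)
  also have "\<dots> + (\<Sum>i\<le>m. real (m choose i) * w (k + Suc i) (m - i)) =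
     (\<Sum>i\<le>m. real (m choose i) * w (k + i) (m - i))"
  proof -
    have "real (m choose i) * w (k + i) (Suc (m - i)) + real (m choose i) * w (k + Suc i) (m - i)
        = real (m choose i) * w (k + i) (m - i)" for i
      unfolding rec[of "k + i" "m - i"] by (simp add: algebra_simps)
    then show ?thesis by (simp add: sum.distrib [symmetric])
  qed
  also have "\<dots> = w k 0" by (rule Suc.IH)
  finally show ?case .
qed

text \<open>Choosing \<open>k\<close> of \<open>n\<close> objects without or with replacement makes little difference for large \<open>n\<close>. The ratio is the product of
the factors \<open>(j - i) / (n - i)\<close>, each of which differs from \<open>j / n\<close> by at most \<open>i / (n - i)\<close>; for \<open>n \<ge> 2 k\<close> all
factors lie in \<open>[-1,1]\<close>, so the errors add up.\<close>

lemma binomial_ratio_near_power: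
  assumes "2 * k \<le> n" "j \<le> n" "0 < n"
  shows "\<bar>real (j choose k) / real (n choose k) - (real j / real n) ^ k\<bar> \<le> (\<Sum>i<k. real i / real (n - i))"
proof -
  define a where "a i = (real j - real i) / (real n - real i)" for i
  have e: "real (j choose k) / real (n choose k) = (\<Prod>i<k. a i)"
    unfolding a_def binomial_gbinomial gbinomial_prod_rev prod_dividef atLeast0LessThan by simp
  have pos: "real n - real i \<ge> real i \<and> real n - real i > 0" if "i < k" for i
    using assms that by linarith
  have a1: "\<bar>a i\<bar> \<le> 1" if "i < k" for i
    unfolding a_def using pos[OF that] assms by (auto simp: abs_le_iff divide_simps)
  have "\<bar>(\<Prod>i<k. a i) - (\<Prod>i<k. real j / real n)\<bar> \<le> (\<Sum>i<k. \<bar>a i - real j / real n\<bar>)"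
    using norm_prod_diff[of "{..<k}" a "\<lambda>_. real j / real n"] a1 assms by simp
  also have "\<dots> \<le> (\<Sum>i<k. real i / real (n - i))"
  proof (rule sum_mono)
    fix i assume "i \<in> {..<k}"
    then have i: "i < k" by simp
    have "a i - real j / real n = - (real i / (real n - real i)) * (1 - real j / real n)"
      unfolding a_def using pos[OF i] assms by (simp add: field_simps)
    moreover have "\<bar>1 - real j / real n\<bar> \<le> 1" using assms by (auto simp: abs_le_iff)
    ultimately have "\<bar>a i - real j / real n\<bar> \<le> \<bar>real i / (real n - real i)\<bar>"
      by (simp only: abs_mult abs_minus_cancel mult_left_le abs_ge_zero)
    then show "\<bar>a i - real j / real n\<bar> \<le> real i / real (n - i)"
      using pos[OF i] i assms by (simp add: of_nat_diff)
  qed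
  finally show ?thesis using e by simp
qed

text \<open>The weights \<open>(n choose j) w j (n - j)\<close> at the points \<open>j / n\<close> have the right factorial moments exactly, not only in the
limit. This holds since \<open>(n choose j) (j choose k) = (n choose k) (n - k choose j - k)\<close>.\<close>

lemma binomial_factorial_moment:
  fixes w :: "nat \<Rightarrow> nat \<Rightarrow> real"
  assumes rec: "\<And>i m. w i m = w (Suc i) m + w i (Suc m)" and "k \<le> n"
  shows "(\<Sum>j\<le>n. real (n choose j) * w j (n - j) * (real (j choose k) / real (n choose k))) = w k 0"
proof -
  have "(\<Sum>j\<le>n. real (n choose j) * w j (n - j) * (real (j choose k) / real (n choose k)))
      = (\<Sum>j\<in>{k..n}. real (n choose j) * w j (n - j) * (real (j choose k) / real (n choose k)))"
    by (rule sum.mono_neutral_right) auto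
  also have "\<dots> = (\<Sum>j\<in>{k..n}. real (n - k choose (j - k)) * w j (n - j))"
  proof (rule sum.cong[OF refl])
    fix j assume j: "j \<in> {k..n}"
    have "real (n choose j) * real (j choose k) = real (n choose k) * real (n - k choose (j - k))"
      using choose_mult[of k j n] j by (metis atLeastAtMost_iff of_nat_mult)
    moreover have "real (n choose k) > 0" using \<open>k \<le> n\<close> by simp
    ultimately show "real (n choose j) * w j (n - j) * (real (j choose k) / real (n choose k)) =
       real (n - k choose (j - k)) * w j (n - j)"
      by (simp add: field_simps)
  qed
  also have "\<dots> = (\<Sum>i\<le>n - k. real (n - k choose i) * w (k + i) (n - k - i))"
    by (rule sum.reindex_bij_witness[of _ "\<lambda>i. k + i" "\<lambda>j. j - k"]) (use \<open>k \<le> n\<close> in auto)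
  also have "\<dots> = w k 0" by (rule binomial_difference_sum[of w "n - k" k, OF rec])
  finally show ?thesis .
qed

text \<open>The discrete measures with weights \<open>(n choose j) w j (n - j)\<close> at the points \<open>j / n\<close> live on \<open>[0,1]\<close>, so by Helly's theorem a
subsequence converges weakly. Their \<open>k\<close>-th moments tend to \<open>w k 0\<close>, as power moments and factorial moments agree in the
limit. The factor \<open>w 0 0\<close> normalizes to a probability distribution; if it vanishes, then so does \<open>w k 0\<close>
for all \<open>k\<close>.\<close>

theorem Hausdorff_moment_problem:
  fixes w :: "nat \<Rightarrow> nat \<Rightarrow> real"
  assumes rec: "\<And>i m. w i m = w (Suc i) m + w i (Suc m)" and nonneg: "\<And>i m. 0 \<le> w i m"
  shows "\<exists>\<rho>. real_distribution \<rho> \<and> (AE t in \<rho>. t \<in> {0..1}) \<and> (\<forall>k. w k 0 = w 0 0 * (\<integral>t. t ^ k \<partial>\<rho>))"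
proof -
  \<comment> \<open>the retraction onto \<open>[0,1]\<close>: it makes the powers bounded and continuous on the whole line without
      changing them at the points \<open>j / n\<close>\<close>
  define clamp :: "real \<Rightarrow> real" where "clamp t = max 0 (min 1 t)" for t
  have clamp01: "clamp t \<in> {0..1}" for t by (auto simp: clamp_def)
  have [measurable]: "clamp \<in> borel_measurable borel" unfolding clamp_def by measurable
  define q where "q n j = (if w 0 0 = 0 then (if j = 0 then 1 else 0)
      else if j \<le> n then real (n choose j) * w j (n - j) / w 0 0 else 0)" for n j :: nat
  have q0: "q n j \<ge> 0" for n j unfolding q_def using nonneg by auto
  have qn: "q n j = 0" if "j > n" for n j using that unfolding q_def by auto
  have q1: "(\<Sum>j\<le>n. q n j) = 1" for n
  proof (cases "w 0 0 = 0")
    case True then show ?thesis by (simp add: q_def)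
  next
    case False
    then show ?thesis
      using binomial_difference_sum[of w n 0, OF rec] by (simp add: q_def flip: sum_divide_distrib)
  qed
  have nn: "(\<integral>\<^sup>+j. ennreal (q n j) \<partial>count_space UNIV) = 1" for n
  proof -
    have "(\<integral>\<^sup>+j. ennreal (q n j) \<partial>count_space UNIV) = (\<Sum>j\<le>n. ennreal (q n j))"
      by (rule nn_integral_count_space'[of "{..n}"]) (auto simp: qn not_le)
    also have "\<dots> = ennreal (\<Sum>j\<le>n. q n j)" by (rule sum_ennreal) (rule q0)
    finally show ?thesis using q1 by simp
  qed
  define p where "p n = embed_pmf (q n)" for n
  have pmf_p: "pmf (p n) j = q n j" for n j
    unfolding p_def by (rule pmf_embed_pmf[OF q0 nn])
  have set_p: "set_pmf (p n) \<subseteq> {..n}" for n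
    by (auto simp: set_pmf_iff pmf_p) (metis qn not_le)
  define \<mu> where "\<mu> n = distr (measure_pmf (p n)) borel (\<lambda>j. real j / real n)" for n
  have int_\<mu>: "(\<integral>t. f t \<partial>\<mu> n) = (\<Sum>j\<le>n. q n j * f (real j / real n))"
    if "f \<in> borel_measurable borel" for f n
    unfolding \<mu>_def using that
    by (subst integral_distr, simp, simp, subst integral_measure_pmf[of "{..n}"])
      (use set_p in \<open>auto simp: pmf_p\<close>)
  have dist_\<mu>: "real_distribution (\<mu> n)" for n
    unfolding \<mu>_def real_distribution_def real_distribution_axioms_def
    by (auto intro: measure_pmf.prob_space_distr)
  have "measure (\<mu> n) {-1<..1} = 1" for n
  proof -
    have "AE j in measure_pmf (p n). real j / real n \<in> {-1<..1}"
    proof (subst AE_measure_pmf_iff, rule ballI)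
      fix j assume "j \<in> set_pmf (p n)"
      then have "j \<le> n" using set_p by auto
      then show "real j / real n \<in> {-1<..1}"
        by (cases "n = 0") (auto intro: less_le_trans[of _ 0])
    qed
    then show ?thesis
      unfolding \<mu>_def by (subst measure_distr) (auto simp: vimage_def measure_pmf.prob_eq_1)
  qed
  then have "tight \<mu>"
    unfolding tight_def using dist_\<mu> by (intro conjI allI impI exI[of _ "-1"] exI[of _ 1]) auto
  then obtain r M where r: "strict_mono (r :: nat \<Rightarrow> nat)" and M: "real_distribution M"
    and conv: "weak_conv_m (\<mu> \<circ> id \<circ> r) M"
    using tight_imp_convergent_subsubsequence[of \<mu> id] by (auto simp: strict_mono_def)
  interpret M: real_distribution M by (rule M)
  have lim1: "(\<lambda>n. \<integral>t. clamp t ^ k \<partial>\<mu> (r n)) \<longlonglongrightarrow> (\<integral>t. clamp t ^ k \<partial>M)" for k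
  proof -
    have "(\<lambda>n. integral\<^sup>L ((\<mu> \<circ> id \<circ> r) n) (\<lambda>t. clamp t ^ k)) \<longlonglongrightarrow> integral\<^sup>L M (\<lambda>t. clamp t ^ k)"
    proof (rule weak_conv_imp_integral_bdd_continuous_conv[OF _ M conv, where B = 1])
      show "isCont (\<lambda>t. clamp t ^ k) x" for x unfolding clamp_def by (intro continuous_intros)
      show "norm (clamp x ^ k) \<le> 1" for x using clamp01[of x] by (auto simp: power_le_one)
      show "real_distribution ((\<mu> \<circ> id \<circ> r) n)" for n using dist_\<mu> by simp
    qed
    then show ?thesis by simp
  qed
  have lim2: "(\<lambda>n. w 0 0 * (\<integral>t. clamp t ^ k \<partial>\<mu> n)) \<longlonglongrightarrow> w k 0" for k
  proof (cases "w 0 0 = 0")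
    case True
    have dec: "w (Suc i) 0 \<le> w i 0" for i using rec[of i 0] nonneg[of i 1] by simp
    have "w k 0 \<le> w 0 0" by (induction k) (use dec order_trans in \<open>blast+\<close>)
    with True nonneg[of k 0] have "w k 0 = 0" by simp
    with True show ?thesis by simp
  next
    case False
    then have pos: "w 0 0 > 0" using nonneg[of 0 0] by simp
    have "eventually (\<lambda>n. norm (w 0 0 * (\<integral>t. clamp t ^ k \<partial>\<mu> n) - w k 0) \<le>
        w 0 0 * (\<Sum>i<k. real i / real (n - i))) sequentially"
      using eventually_ge_at_top[of "2 * k + 1"]
    proof eventually_elim
      case (elim n)
      let ?e = "\<Sum>i<k. real i / real (n - i)"
      have "w 0 0 * (\<integral>t. clamp t ^ k \<partial>\<mu> n) = (\<Sum>j\<le>n. w 0 0 * q n j * (real j / real n) ^ k)"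
      proof (subst int_\<mu>)
        show "w 0 0 * (\<Sum>j\<le>n. q n j * clamp (real j / real n) ^ k) =
          (\<Sum>j\<le>n. w 0 0 * q n j * (real j / real n) ^ k)"
          unfolding sum_distrib_left by (intro sum.cong refl) (use elim in \<open>simp add: clamp_def\<close>)
      qed measurable
      moreover have "w k 0 = (\<Sum>j\<le>n. w 0 0 * q n j * (real (j choose k) / real (n choose k)))"
        using binomial_factorial_moment[of w k n, OF rec] elim False by (simp add: q_def)
      ultimately have "norm (w 0 0 * (\<integral>t. clamp t ^ k \<partial>\<mu> n) - w k 0) =
         \<bar>\<Sum>j\<le>n. w 0 0 * q n j * (real (j choose k) / real (n choose k) - (real j / real n) ^ k)\<bar>"
        by (simp add: sum_subtractf right_diff_distrib abs_minus_commute)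
      also have "\<dots> \<le> (\<Sum>j\<le>n. \<bar>w 0 0 * q n j * (real (j choose k) / real (n choose k) - (real j / real n) ^ k)\<bar>)"
        by (rule sum_abs)
      also have "\<dots> \<le> (\<Sum>j\<le>n. w 0 0 * q n j * ?e)"
        using binomial_ratio_near_power[of k n] elim pos q0
        by (intro sum_mono) (auto simp: abs_mult intro!: mult_mono)
      also have "\<dots> = w 0 0 * ?e"
        using q1[of n] by (simp flip: sum_distrib_right sum_distrib_left)
      finally show ?case .
    qed
    moreover have "(\<lambda>n. w 0 0 * (\<Sum>i<k. real i / real (n - i))) \<longlonglongrightarrow> 0"
    proof -
      have "(\<lambda>n. w 0 0 * (\<Sum>i<k. real i / real (n - i))) \<longlonglongrightarrow> w 0 0 * (\<Sum>i<k. 0)"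
    proof (intro tendsto_intros)
      fix i
      have "(\<lambda>n. real i / real (n + i - i)) \<longlonglongrightarrow> 0"
        using lim_const_over_n[of "real i"] by simp
      then show "(\<lambda>n. real i / real (n - i)) \<longlonglongrightarrow> 0"
        by (rule LIMSEQ_offset[where k = i])
    qed
    then show ?thesis by simp
    qed
    ultimately have "(\<lambda>n. w 0 0 * (\<integral>t. clamp t ^ k \<partial>\<mu> n) - w k 0) \<longlonglongrightarrow> 0"
      by (rule Lim_null_comparison)
    then show ?thesis by (rule LIM_zero_cancel)
  qed
  \<comment> \<open>the weak limit is pushed into \<open>[0,1]\<close>, which leaves the integrals of powers of \<open>clamp\<close> unchanged\<close>
  define \<rho> where "\<rho> = distr M borel clamp"
  have "w k 0 = w 0 0 * (\<integral>t. t ^ k \<partial>\<rho>)" for k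
  proof -
    have "(\<lambda>n. w 0 0 * (\<integral>t. clamp t ^ k \<partial>\<mu> (r n))) \<longlonglongrightarrow> w k 0"
      using LIMSEQ_subseq_LIMSEQ[OF lim2 r] by (simp add: o_def)
    moreover have "(\<lambda>n. w 0 0 * (\<integral>t. clamp t ^ k \<partial>\<mu> (r n))) \<longlonglongrightarrow> w 0 0 * (\<integral>t. clamp t ^ k \<partial>M)"
      by (intro tendsto_intros lim1)
    ultimately have "w k 0 = w 0 0 * (\<integral>t. clamp t ^ k \<partial>M)" by (rule LIMSEQ_unique)
    then show ?thesis unfolding \<rho>_def by (subst integral_distr) simp_all
  qed
  moreover have "real_distribution \<rho>"
    unfolding \<rho>_def real_distribution_def real_distribution_axioms_def
    by (auto intro: M.prob_space_distr)
  moreover have "AE t in \<rho>. t \<in> {0..1}"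
    unfolding \<rho>_def using clamp01 by (subst AE_distr_iff) auto
  ultimately show ?thesis by blast
qed

section \<open>Functionals determined by their moments\<close>

definition unit_bounded :: "(real \<Rightarrow> real) set" where
  "unit_bounded = {f \<in> borel_measurable borel. \<exists>C. \<forall>t\<in>{0..1}. \<bar>f t\<bar> \<le> C}"

text \<open>The laws of integration of bounded Borel functions against a complex measure on \<open>[0,1]\<close>. Continuity under bounded
convergence replaces countable additivity. Only the values of a function on \<open>[0,1]\<close> are constrained, so that
powers count as bounded.\<close>

definition sigma_functional :: "((real \<Rightarrow> real) \<Rightarrow> complex) \<Rightarrow> bool" where
  "sigma_functional F \<longleftrightarrow>
     (\<forall>f\<in>unit_bounded. \<forall>g\<in>unit_bounded. F (\<lambda>t. f t + g t) = F f + F g) \<and>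
     (\<forall>c. \<forall>f\<in>unit_bounded. F (\<lambda>t. c * f t) = complex_of_real c * F f) \<and>
     (\<forall>f g C. (\<forall>n. f n \<in> borel_measurable borel) \<longrightarrow> g \<in> borel_measurable borel \<longrightarrow>
        (\<forall>n. \<forall>t\<in>{0..1}. \<bar>f n t\<bar> \<le> C) \<longrightarrow> (\<forall>t\<in>{0..1}. (\<lambda>n. f n t) \<longlonglongrightarrow> g t) \<longrightarrow>
        (\<lambda>n. F (f n)) \<longlonglongrightarrow> F g)"

lemma unit_boundedI:
  "f \<in> borel_measurable borel \<Longrightarrow> (\<And>t. t \<in> {0..1} \<Longrightarrow> \<bar>f t\<bar> \<le> C) \<Longrightarrow> f \<in> unit_bounded"
  unfolding unit_bounded_def by blast

lemma unit_bounded_add: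
  assumes "f \<in> unit_bounded" "g \<in> unit_bounded" shows "(\<lambda>t. f t + g t) \<in> unit_bounded"
proof -
  obtain C D where "\<forall>t\<in>{0..1}. \<bar>f t\<bar> \<le> C" "\<forall>t\<in>{0..1}. \<bar>g t\<bar> \<le> D"
    using assms unfolding unit_bounded_def by blast
  then have "\<bar>f t + g t\<bar> \<le> C + D" if "t \<in> {0..1}" for t
    using that by (meson abs_triangle_ineq add_mono order_trans)
  moreover have "(\<lambda>t. f t + g t) \<in> borel_measurable borel"
    using assms unfolding unit_bounded_def by auto
  ultimately show ?thesis by (intro unit_boundedI)
qed

lemma unit_bounded_mult:
  assumes "f \<in> unit_bounded" "g \<in> unit_bounded" shows "(\<lambda>t. f t * g t) \<in> unit_bounded"
proof -
  obtain C D where CD: "\<forall>t\<in>{0..1}. \<bar>f t\<bar> \<le> C" "\<forall>t\<in>{0..1}. \<bar>g t\<bar> \<le> D"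
    using assms unfolding unit_bounded_def by blast
  have "\<bar>f t * g t\<bar> \<le> C * D" if "t \<in> {0..1}" for t
    unfolding abs_mult by (intro mult_mono) (use CD that in \<open>auto intro: order_trans[OF abs_ge_zero]\<close>)
  moreover have "(\<lambda>t. f t * g t) \<in> borel_measurable borel"
    using assms unfolding unit_bounded_def by auto
  ultimately show ?thesis by (intro unit_boundedI)
qed

lemma unit_bounded_power: "(\<lambda>t. t ^ k) \<in> unit_bounded"
  by (rule unit_boundedI[where C = 1]) (auto simp: power_le_one)

lemma unit_bounded_const: "(\<lambda>t. c) \<in> unit_bounded"
  by (rule unit_boundedI[where C = "\<bar>c\<bar>"]) auto

lemma unit_bounded_indicator: "S \<in> sets borel \<Longrightarrow> indicator S \<in> unit_bounded"
  by (rule unit_boundedI[where C = 1]) (auto simp: indicator_def)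

lemma unit_bounded_sum:
  "(\<And>i. i \<in> I \<Longrightarrow> f i \<in> unit_bounded) \<Longrightarrow> (\<lambda>t. \<Sum>i\<in>I. f i t) \<in> unit_bounded"
  by (induction I rule: infinite_finite_induct) (auto intro: unit_bounded_add unit_bounded_const)

lemma sigma_functional_add:
  "sigma_functional F \<Longrightarrow> f \<in> unit_bounded \<Longrightarrow> g \<in> unit_bounded \<Longrightarrow> F (\<lambda>t. f t + g t) = F f + F g"
  unfolding sigma_functional_def by blast

lemma sigma_functional_scale:
  "sigma_functional F \<Longrightarrow> f \<in> unit_bounded \<Longrightarrow> F (\<lambda>t. c * f t) = complex_of_real c * F f"
  unfolding sigma_functional_def by blast

lemma sigma_functional_tendsto:
  "sigma_functional F \<Longrightarrow> (\<And>n. f n \<in> borel_measurable borel) \<Longrightarrow> g \<in> borel_measurable borel \<Longrightarrow>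
   (\<And>n t. t \<in> {0..1} \<Longrightarrow> \<bar>f n t\<bar> \<le> C) \<Longrightarrow> (\<And>t. t \<in> {0..1} \<Longrightarrow> (\<lambda>n. f n t) \<longlonglongrightarrow> g t) \<Longrightarrow>
   (\<lambda>n. F (f n)) \<longlonglongrightarrow> F g"
  unfolding sigma_functional_def by blast

lemma sigma_functional_diff:
  assumes "sigma_functional F" "f \<in> unit_bounded" "g \<in> unit_bounded"
  shows "F (\<lambda>t. f t - g t) = F f - F g"
proof -
  have "(\<lambda>t. -1 * g t) \<in> unit_bounded"
    by (intro unit_bounded_mult unit_bounded_const assms)
  with sigma_functional_add[OF assms(1,2) this] sigma_functional_scale[OF assms(1,3), of "-1"]
  show ?thesis by simp
qed

lemma sigma_functional_zero: "sigma_functional F \<Longrightarrow> F (\<lambda>t. 0) = 0"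
  using sigma_functional_scale[OF _ unit_bounded_const, of F 0 0] by simp

lemma sigma_functional_sum:
  assumes "sigma_functional F" "\<And>i. i \<in> I \<Longrightarrow> f i \<in> unit_bounded"
  shows "F (\<lambda>t. \<Sum>i\<in>I. f i t) = (\<Sum>i\<in>I. F (f i))"
  using assms(2)
proof (induction I rule: infinite_finite_induct)
  case (insert i I)
  then show ?case
    using sigma_functional_add[OF assms(1), of "f i" "\<lambda>t. \<Sum>i\<in>I. f i t"] by (simp add: unit_bounded_sum)
qed (use sigma_functional_zero[OF assms(1)] in auto)

lemma sigma_functional_cong:
  assumes F: "sigma_functional F" and f: "f \<in> unit_bounded" and g: "g \<in> borel_measurable borel"
    and eq: "\<And>t. t \<in> {0..1} \<Longrightarrow> f t = g t"
  shows "F f = F g"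
proof -
  obtain C where C: "\<And>t. t \<in> {0..1} \<Longrightarrow> \<bar>f t\<bar> \<le> C" and m: "f \<in> borel_measurable borel"
    using f unfolding unit_bounded_def by blast
  have "(\<lambda>n::nat. F f) \<longlonglongrightarrow> F g"
    by (rule sigma_functional_tendsto[OF F m g C]) (auto simp: eq)
  then show ?thesis by (simp add: LIMSEQ_const_iff)
qed

lemma sigma_functional_plus:
  "sigma_functional F \<Longrightarrow> sigma_functional G \<Longrightarrow> sigma_functional (\<lambda>f. F f + G f)"
  unfolding sigma_functional_def
  by (intro conjI allI ballI impI; (simp add: algebra_simps)?; intro tendsto_add; blast)

lemma sigma_functional_times:
  "sigma_functional F \<Longrightarrow> sigma_functional (\<lambda>f. c * F f)"
  unfolding sigma_functional_def
  by (intro conjI allI ballI impI; (simp add: algebra_simps)?; intro tendsto_mult tendsto_const; blast)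

lemma sigma_functional_minus:
  "sigma_functional F \<Longrightarrow> sigma_functional G \<Longrightarrow> sigma_functional (\<lambda>f. F f - G f)"
  using sigma_functional_plus[OF _ sigma_functional_times, of F G "-1"] by simp

lemma sigma_functional_cnj:
  "sigma_functional F \<Longrightarrow> sigma_functional (\<lambda>f. cnj (F f))"
  unfolding sigma_functional_def
  by (intro conjI allI ballI impI; (simp add: algebra_simps)?; intro tendsto_cnj; blast)

text \<open>Multiplication of a measure by a bounded density.\<close>

lemma sigma_functional_weight:
  assumes F: "sigma_functional F" and g: "g \<in> unit_bounded"
  shows "sigma_functional (\<lambda>f. F (\<lambda>t. g t * f t))"
  unfolding sigma_functional_def
proof (intro conjI allI ballI impI)
  fix f h assume "f \<in> unit_bounded" "h \<in> unit_bounded"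
  then show "F (\<lambda>t. g t * (f t + h t)) = F (\<lambda>t. g t * f t) + F (\<lambda>t. g t * h t)"
    using sigma_functional_add[OF F unit_bounded_mult[OF g] unit_bounded_mult[OF g]]
    by (simp add: distrib_left)
next
  fix c f assume "f \<in> unit_bounded"
  then show "F (\<lambda>t. g t * (c * f t)) = complex_of_real c * F (\<lambda>t. g t * f t)"
    using sigma_functional_scale[OF F unit_bounded_mult[OF g], of f c] by (simp add: mult.left_commute)
next
  fix f :: "nat \<Rightarrow> real \<Rightarrow> real" and h C
  assume f: "\<forall>n. f n \<in> borel_measurable borel" and h: "h \<in> borel_measurable borel"
    and C: "\<forall>n. \<forall>t\<in>{0..1}. \<bar>f n t\<bar> \<le> C" and lim: "\<forall>t\<in>{0..1}. (\<lambda>n. f n t) \<longlonglongrightarrow> h t"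
  obtain D where D: "\<And>t. t \<in> {0..1} \<Longrightarrow> \<bar>g t\<bar> \<le> D" and m: "g \<in> borel_measurable borel"
    using g unfolding unit_bounded_def by blast
  have fm: "f n \<in> borel_measurable borel" for n using f by blast
  show "(\<lambda>n. F (\<lambda>t. g t * f n t)) \<longlonglongrightarrow> F (\<lambda>t. g t * h t)"
  proof (rule sigma_functional_tendsto[OF F, where C = "D * C"])
    show "\<bar>g t * f n t\<bar> \<le> D * C" if "t \<in> {0..1}" for n t
      unfolding abs_mult by (intro mult_mono) (use C D[OF that] that in \<open>auto intro: order_trans[OF abs_ge_zero]\<close>)
    show "(\<lambda>t. g t * f n t) \<in> borel_measurable borel" for n
      by (rule borel_measurable_times[OF m fm])
    show "(\<lambda>t. g t * h t) \<in> borel_measurable borel"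
      by (rule borel_measurable_times[OF m h])
    show "(\<lambda>n. g t * f n t) \<longlonglongrightarrow> g t * h t" if "t \<in> {0..1}" for t
      using lim that by (intro tendsto_mult tendsto_const) blast
  qed
qed

lemma sigma_functional_integral:
  assumes \<rho>: "real_distribution \<rho>" and ae: "AE t in \<rho>. t \<in> {0..1}"
  shows "sigma_functional (\<lambda>f. complex_of_real (\<integral>t. f t \<partial>\<rho>))"
proof -
  interpret real_distribution \<rho> by (rule \<rho>)
  have int: "integrable \<rho> f" if "f \<in> unit_bounded" for f
  proof -
    obtain C where "\<And>t. t \<in> {0..1} \<Longrightarrow> \<bar>f t\<bar> \<le> C" and m: "f \<in> borel_measurable borel"
      using \<open>f \<in> unit_bounded\<close> unfolding unit_bounded_def by blast
    then have "AE t in \<rho>. norm (f t) \<le> C" using ae by (auto elim: eventually_mono)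
    then show ?thesis using m by (intro integrable_const_bound) auto
  qed
  show ?thesis
    unfolding sigma_functional_def
  proof (intro conjI allI ballI impI)
    fix f :: "nat \<Rightarrow> real \<Rightarrow> real" and h C
    assume f: "\<forall>n. f n \<in> borel_measurable borel" and h: "h \<in> borel_measurable borel"
      and C: "\<forall>n. \<forall>t\<in>{0..1}. \<bar>f n t\<bar> \<le> C" and lim: "\<forall>t\<in>{0..1}. (\<lambda>n. f n t) \<longlonglongrightarrow> h t"
    have "(\<lambda>n. \<integral>t. f n t \<partial>\<rho>) \<longlonglongrightarrow> (\<integral>t. h t \<partial>\<rho>)"
    proof (rule integral_dominated_convergence[where w = "\<lambda>_. C"])
      show "AE t in \<rho>. (\<lambda>n. f n t) \<longlonglongrightarrow> h t" using ae lim by (auto elim: eventually_mono)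
      show "AE t in \<rho>. norm (f n t) \<le> C" for n using ae C by (auto elim: eventually_mono)
    qed (use f h in auto)
    then show "(\<lambda>n. complex_of_real (\<integral>t. f n t \<partial>\<rho>)) \<longlonglongrightarrow> complex_of_real (\<integral>t. h t \<partial>\<rho>)"
      by (rule tendsto_of_real)
  qed (use int in auto)
qed

text \<open>If all moments vanish, then the functional vanishes on Bernstein polynomials, hence by uniform approximation on bounded continuous
functions, hence by bounded limits on the indicators of half-lines, and finally by Dynkin's theorem on those of all Borel
sets.\<close>

lemma sigma_functional_vanishes_on_borel:
  assumes F: "sigma_functional F" and mom: "\<And>k. F (\<lambda>t. t ^ k) = 0" and S: "S \<in> sets borel"
  shows "F (indicator S) = 0"
proof -
  have ub: "(\<lambda>t. t ^ k * (1 - t) ^ m) \<in> unit_bounded" for k m :: nat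
    by (rule unit_boundedI[where C = 1]) (auto simp: abs_mult intro!: mult_le_one power_le_one)
  have bern: "F (\<lambda>t. t ^ k * (1 - t) ^ m) = 0" for k m
  proof (induction m arbitrary: k)
    case 0 then show ?case using mom by simp
  next
    case (Suc m)
    have "F (\<lambda>t. t ^ k * (1 - t) ^ m - t ^ Suc k * (1 - t) ^ m) = 0"
      by (subst sigma_functional_diff[OF F ub ub]) (simp only: Suc.IH diff_self)
    moreover have "t ^ k * (1 - t) ^ m - t ^ Suc k * (1 - t) ^ m = t ^ k * (1 - t) ^ Suc m" for t :: real
      by (simp add: algebra_simps)
    ultimately show ?case by simp
  qed
  have cont: "F f = 0" if f: "continuous_on UNIV f" and C: "\<And>t. \<bar>f t\<bar> \<le> C" for f :: "real \<Rightarrow> real" and C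
  proof -
    define p where "p n t = (\<Sum>k\<le>n. f (real k / real n) * Bernstein n k t)" for n t
    have "F (p n) = (\<Sum>k\<le>n. F (\<lambda>t. (f (real k / real n) * real (n choose k)) * (t ^ k * (1 - t) ^ (n - k))))" for n
      unfolding p_def Bernstein_def
      by (subst sigma_functional_sum[OF F, symmetric])
        (auto intro!: unit_bounded_mult[OF unit_bounded_const] ub simp: mult.assoc)
    then have 0: "F (p n) = 0" for n
      by (simp only: sigma_functional_scale[OF F ub] bern) simp
    have "(\<lambda>n. F (p n)) \<longlonglongrightarrow> F f"
    proof (rule sigma_functional_tendsto[OF F, where C = C])
      show "p n \<in> borel_measurable borel" for n
        unfolding p_def Bernstein_def by measurable
      show "f \<in> borel_measurable borel" using f by (rule borel_measurable_continuous_onI)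
      fix t :: real assume t: "t \<in> {0..1}"
      show "\<bar>p n t\<bar> \<le> C" for n
      proof -
        have "\<bar>p n t\<bar> \<le> (\<Sum>k\<le>n. C * Bernstein n k t)"
          unfolding p_def using t C
          by (intro order_trans[OF sum_abs] sum_mono) (auto simp: abs_mult Bernstein_nonneg intro!: mult_right_mono)
        then show ?thesis by (simp flip: sum_distrib_left)
      qed
      show "(\<lambda>n. p n t) \<longlonglongrightarrow> f t"
      proof (rule LIMSEQ_I)
        fix e :: real assume "e > 0"
        then obtain N where "\<forall>n x. N \<le> n \<and> x \<in> {0..1} \<longrightarrow> \<bar>f x - p n x\<bar> < e"
          using Bernstein_Weierstrass[of f e] continuous_on_subset[OF f] unfolding p_def by auto
        then show "\<exists>N. \<forall>n\<ge>N. norm (p n t - f t) < e"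
          using t by (auto simp: abs_minus_commute)
      qed
    qed
    then show ?thesis by (simp add: 0 LIMSEQ_const_iff)
  qed
  have atMost: "F (indicator {..c}) = 0" for c :: real
  proof -
    \<comment> \<open>continuous ramps that decrease to the indicator of the half-line\<close>
    define f where "f n t = max 0 (min 1 (1 - real n * (t - c)))" for n t
    have "F (f n) = 0" for n
      unfolding f_def by (rule cont[where C = 1]) (auto intro!: continuous_intros)
    moreover have "(\<lambda>n. F (f n)) \<longlonglongrightarrow> F (indicator {..c})"
    proof (rule sigma_functional_tendsto[OF F, where C = 1])
      show "f n \<in> borel_measurable borel" for n unfolding f_def by measurable
      show "\<bar>f n t\<bar> \<le> 1" for n t unfolding f_def by auto
      show "(\<lambda>n. f n t) \<longlonglongrightarrow> indicator {..c} t" for t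
      proof (cases "t \<le> c")
        case True
        then have "f n t = 1" for n
          unfolding f_def by (simp add: mult_nonneg_nonpos)
        with True show ?thesis by simp
      next
        case False
        then obtain N where N: "1 < real N * (t - c)"
          using reals_Archimedean3[of "t - c"] by auto
        have "f n t = 0" if "n \<ge> N" for n
        proof -
          have "real N * (t - c) \<le> real n * (t - c)"
            using that False by (intro mult_right_mono) auto
          with N show ?thesis unfolding f_def by simp
        qed
        then have "eventually (\<lambda>n. f n t = indicator {..c} t) sequentially"
          using False by (auto simp: eventually_sequentially indicator_def)
        then show ?thesis by (rule tendsto_eventually)
      qed
    qed auto
    ultimately show ?thesis by (simp add: LIMSEQ_const_iff)
  qed
  have gen: "sets borel = sigma_sets UNIV (range (\<lambda>c::real. {..c}))"
    by (subst borel_eq_atMost) auto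
  have "Int_stable (range (\<lambda>c::real. {..c}))"
    by (auto simp: Int_stable_def)
  moreover have "range (\<lambda>c::real. {..c}) \<subseteq> Pow UNIV" by simp
  moreover have "S \<in> sigma_sets UNIV (range (\<lambda>c::real. {..c}))" using S gen by simp
  ultimately show ?thesis
  proof (induction rule: sigma_sets_induct_disjoint)
    case (basic A) then show ?case using atMost by auto
  next
    case empty
    then show ?case using sigma_functional_zero[OF F] by (simp add: indicator_def[abs_def])
  next
    case (compl A)
    have "F (\<lambda>t. 1 - indicator A t) = 0"
      using compl gen sigma_functional_diff[OF F unit_bounded_const unit_bounded_indicator] mom[of 0] by simp
    moreover have "(\<lambda>t. 1 - indicator A t) = (indicator (UNIV - A) :: real \<Rightarrow> real)"
      by (auto simp: indicator_def)
    ultimately show ?case by simp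
  next
    case (union A)
    have A: "A i \<in> sets borel" for i using union(2) gen by auto
    have "F (\<lambda>t. \<Sum>i<n. indicator (A i) t) = 0" for n
      by (subst sigma_functional_sum[OF F]) (use union A in \<open>auto intro: unit_bounded_indicator\<close>)
    moreover have "(\<lambda>n. F (\<lambda>t. \<Sum>i<n. indicator (A i) t)) \<longlonglongrightarrow> F (indicator (\<Union>i. A i))"
    proof (rule sigma_functional_tendsto[OF F, where C = 1])
      fix n and t :: real
      have "(\<Sum>i<n. indicator (A i) t) = (indicator (\<Union>i<n. A i) t :: real)"
        using union(1) by (subst indicator_UN_disjoint) (auto simp: disjoint_family_on_def)
      then show "\<bar>\<Sum>i<n. indicator (A i) t\<bar> \<le> (1::real)" by (simp add: indicator_def)
    next
      fix t :: real
      show "(\<lambda>n. \<Sum>i<n. indicator (A i) t :: real) \<longlonglongrightarrow> indicator (\<Union>i. A i) t"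
        using indicator_sums[of A t] union(1) unfolding sums_def disjoint_family_on_def by auto
    qed (use A in auto)
    ultimately show ?case by (simp add: LIMSEQ_const_iff)
  qed
qed

theorem sigma_functional_determined_by_moments:
  assumes "sigma_functional F" "sigma_functional G" "\<And>k. F (\<lambda>t. t ^ k) = G (\<lambda>t. t ^ k)" "S \<in> sets borel"
  shows "F (indicator S) = G (indicator S)"
  using sigma_functional_vanishes_on_borel[OF sigma_functional_minus[OF assms(1,2)] _ assms(4)] assms(3)
  by simp

section \<open>Square-summable sequences and Hermitian forms\<close>

lemma ell2_iff_bounded_sums: "x \<in> ell2 \<longleftrightarrow> (\<exists>C. \<forall>N. (\<Sum>n<N. (norm (x n))\<^sup>2) \<le> C)"
proof
  assume "x \<in> ell2"
  then have "(\<Sum>n<N. (norm (x n))\<^sup>2) \<le> (\<Sum>n. (norm (x n))\<^sup>2)" for N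
    unfolding ell2_def by (intro sum_le_suminf) auto
  then show "\<exists>C. \<forall>N. (\<Sum>n<N. (norm (x n))\<^sup>2) \<le> C" by blast
next
  assume "\<exists>C. \<forall>N. (\<Sum>n<N. (norm (x n))\<^sup>2) \<le> C"
  then obtain C where "\<And>N. (\<Sum>n<N. (norm (x n))\<^sup>2) \<le> C" by blast
  then have "summable (\<lambda>n. (norm (x n))\<^sup>2)"
    by (intro bounded_imp_summable[where B = C]) (simp_all only: lessThan_Suc_atMost[symmetric] zero_le_power2)
  then show "x \<in> ell2" by (simp add: ell2_def)
qed

lemma ell2_scale: "x \<in> ell2 \<Longrightarrow> (\<lambda>n. c * x n) \<in> ell2"
  unfolding ell2_def by (auto simp: norm_mult power_mult_distrib intro: summable_mult)

lemma ell2_comparison: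
  assumes "y \<in> ell2" "\<And>n. norm (x n) \<le> K * norm (y n)" shows "x \<in> ell2"
proof -
  have "norm ((norm (x n))\<^sup>2) \<le> K\<^sup>2 * (norm (y n))\<^sup>2" for n
    using power_mono[OF assms(2)[of n], of 2] by (simp add: power_mult_distrib)
  moreover have "summable (\<lambda>n. K\<^sup>2 * (norm (y n))\<^sup>2)"
    using assms(1) unfolding ell2_def by (auto intro: summable_mult)
  ultimately have "summable (\<lambda>n. (norm (x n))\<^sup>2)" by (rule summable_comparison_test'[rotated])
  then show ?thesis unfolding ell2_def by simp
qed

lemma ell2_add:
  assumes "x \<in> ell2" "y \<in> ell2" shows "(\<lambda>n. x n + y n) \<in> ell2"
proof -
  have "norm ((norm (x n + y n))\<^sup>2) \<le> 2 * (norm (x n))\<^sup>2 + 2 * (norm (y n))\<^sup>2" for n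
  proof -
    have "(norm (x n + y n))\<^sup>2 \<le> (norm (x n) + norm (y n))\<^sup>2"
      by (intro power_mono norm_triangle_ineq) auto
    also have "\<dots> \<le> 2 * (norm (x n))\<^sup>2 + 2 * (norm (y n))\<^sup>2"
      using sum_squares_bound[of "norm (x n)" "norm (y n)"] by (simp add: power2_sum)
    finally show ?thesis by simp
  qed
  moreover have "summable (\<lambda>n. 2 * (norm (x n))\<^sup>2 + 2 * (norm (y n))\<^sup>2)"
    using assms unfolding ell2_def by (intro summable_add summable_mult) auto
  ultimately show ?thesis unfolding ell2_def by (auto intro: summable_comparison_test')
qed

lemma ell2_diff: "x \<in> ell2 \<Longrightarrow> y \<in> ell2 \<Longrightarrow> (\<lambda>n. x n - y n) \<in> ell2"
  using ell2_add[of x "\<lambda>n. -1 * y n"] ell2_scale[of y "-1"] by simp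

lemma ell2_finite_support:
  assumes "\<And>n. n \<ge> N \<Longrightarrow> x n = 0" shows "x \<in> ell2"
  unfolding ell2_def using assms by (auto intro!: summable_finite[of "{..<N}"]) (metis not_le)

lemma unit_vec_ell2: "unit_vec j \<in> ell2"
  by (rule ell2_finite_support[of "Suc j"]) (auto simp: unit_vec_def)

lemma ell2_zero: "(\<lambda>n. 0) \<in> ell2"
  by (rule ell2_finite_support) auto

lemma summable_ell2_inner:
  assumes "x \<in> ell2" "y \<in> ell2" shows "summable (\<lambda>n. x n * cnj (y n))"
proof (rule summable_comparison_test')
  show "summable (\<lambda>n. (norm (x n))\<^sup>2 + (norm (y n))\<^sup>2)"
    using assms unfolding ell2_def by (auto intro: summable_add)
  show "norm (x n * cnj (y n)) \<le> (norm (x n))\<^sup>2 + (norm (y n))\<^sup>2" for n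
    using sum_squares_bound[of "norm (x n)" "norm (y n)"]
      mult_nonneg_nonneg[OF norm_ge_zero norm_ge_zero, of "x n" "y n"]
    by (simp add: norm_mult del: mult_nonneg_nonneg)
qed

text \<open>The inner product, the forms of symmetric operators and the polarized integrals all obey these laws, so Cauchy-Schwarz and
polarization are shared. The laws are restricted to \<open>ell2\<close>, where the series converge.\<close>

definition hermitian_form :: "((nat \<Rightarrow> complex) \<Rightarrow> (nat \<Rightarrow> complex) \<Rightarrow> complex) \<Rightarrow> bool" where
  "hermitian_form b \<longleftrightarrow>
     (\<forall>x\<in>ell2. \<forall>y\<in>ell2. \<forall>z\<in>ell2. b (\<lambda>n. x n + y n) z = b x z + b y z) \<and>
     (\<forall>c. \<forall>x\<in>ell2. \<forall>z\<in>ell2. b (\<lambda>n. c * x n) z = c * b x z) \<and>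
     (\<forall>x\<in>ell2. \<forall>y\<in>ell2. b y x = cnj (b x y))"

context
  fixes b assumes b: "hermitian_form b"
begin

lemma form_add_left:
  "x \<in> ell2 \<Longrightarrow> y \<in> ell2 \<Longrightarrow> z \<in> ell2 \<Longrightarrow> b (\<lambda>n. x n + y n) z = b x z + b y z"
  by (rule b[unfolded hermitian_form_def, THEN conjunct1, rule_format])

lemma form_scale_left: "x \<in> ell2 \<Longrightarrow> z \<in> ell2 \<Longrightarrow> b (\<lambda>n. c * x n) z = c * b x z"
  by (rule b[unfolded hermitian_form_def, THEN conjunct2, THEN conjunct1, rule_format])

lemma form_cnj: "x \<in> ell2 \<Longrightarrow> y \<in> ell2 \<Longrightarrow> b y x = cnj (b x y)"
  by (rule b[unfolded hermitian_form_def, THEN conjunct2, THEN conjunct2, rule_format])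

lemma form_diff_left:
  assumes "x \<in> ell2" "y \<in> ell2" "z \<in> ell2"
  shows "b (\<lambda>n. x n - y n) z = b x z - b y z"
proof -
  have "b (\<lambda>n. x n + (-1) * y n) z = b x z + (-1) * b y z"
    using assms by (simp only: form_add_left form_scale_left ell2_scale)
  then show ?thesis by simp
qed

lemma form_add_right:
  assumes "x \<in> ell2" "y \<in> ell2" "z \<in> ell2"
  shows "b x (\<lambda>n. y n + z n) = b x y + b x z"
proof -
  have "b x (\<lambda>n. y n + z n) = cnj (b y x + b z x)"
    using form_cnj[OF ell2_add[OF assms(2,3)] assms(1)] form_add_left[OF assms(2,3,1)] by metis
  then show ?thesis
    unfolding form_cnj[OF assms(2,1)] form_cnj[OF assms(3,1)] by simp
qed

lemma form_scale_right:
  assumes "x \<in> ell2" "y \<in> ell2"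
  shows "b x (\<lambda>n. c * y n) = cnj c * b x y"
proof -
  have "b x (\<lambda>n. c * y n) = cnj (c * b y x)"
    using form_cnj[OF ell2_scale[OF assms(2)] assms(1)] form_scale_left[OF assms(2,1)] by metis
  then show ?thesis unfolding form_cnj[OF assms(2,1)] by simp
qed

lemma form_diff_right:
  assumes "x \<in> ell2" "y \<in> ell2" "z \<in> ell2"
  shows "b x (\<lambda>n. y n - z n) = b x y - b x z"
proof -
  have "b x (\<lambda>n. y n + (-1) * z n) = b x y + cnj (-1) * b x z"
    using assms by (simp only: form_add_right form_scale_right ell2_scale)
  then show ?thesis by simp
qed

lemma form_diagonal_real: "x \<in> ell2 \<Longrightarrow> b x x = complex_of_real (Re (b x x))"
proof -
  assume "x \<in> ell2"
  then have "Im (b x x) = Im (cnj (b x x))" by (intro arg_cong[of _ _ Im] form_cnj)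
  then show ?thesis by (intro complex_eqI) simp_all
qed

lemma form_sum_minus_difference:
  assumes x: "x \<in> ell2" and y: "y \<in> ell2"
  shows "Re (b (\<lambda>n. x n + y n) (\<lambda>n. x n + y n)) - Re (b (\<lambda>n. x n - y n) (\<lambda>n. x n - y n)) = 4 * Re (b x y)"
proof -
  have "b (\<lambda>n. x n + y n) (\<lambda>n. x n + y n) = b x x + b x y + (b y x + b y y)"
    using x y by (simp add: form_add_left form_add_right ell2_add)
  moreover have "b (\<lambda>n. x n - y n) (\<lambda>n. x n - y n) = b x x - b x y - (b y x - b y y)"
    using x y by (simp add: form_diff_left form_diff_right ell2_diff)
  moreover have "Re (b y x) = Re (b x y)" using form_cnj[OF x y] by simp
  ultimately show ?thesis by simp
qed

text \<open>A Hermitian form is determined by its diagonal. This is what allows passing from the measures of single vectors to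
operators.\<close>

lemma form_polarization:
  assumes x: "x \<in> ell2" and y: "y \<in> ell2"
  shows "b x y =
    (complex_of_real (Re (b (\<lambda>n. x n + y n) (\<lambda>n. x n + y n))) -
     complex_of_real (Re (b (\<lambda>n. x n - y n) (\<lambda>n. x n - y n))) +
     \<i> * (complex_of_real (Re (b (\<lambda>n. x n + \<i> * y n) (\<lambda>n. x n + \<i> * y n))) -
          complex_of_real (Re (b (\<lambda>n. x n - \<i> * y n) (\<lambda>n. x n - \<i> * y n))))) / 4"
proof -
  have "Re (b x (\<lambda>n. \<i> * y n)) = Im (b x y)"
    unfolding form_scale_right[OF x y] by simp
  then show ?thesis
    using form_sum_minus_difference[OF x y] form_sum_minus_difference[OF x ell2_scale[OF y], of \<i>]
    unfolding of_real_diff[symmetric] by (intro complex_eqI) simp_all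
qed

text \<open>Positivity of the form at \<open>s x - r b(x,y) y\<close> gives a quadratic inequality in the real parameters \<open>s\<close> and \<open>r\<close>. For
\<open>b(y,y) > 0\<close> the choice \<open>s = b(y,y)\<close>, \<open>r = 1\<close> yields the claim; for \<open>b(y,y) = 0\<close> the inequality is affine in \<open>r\<close>,
which forces \<open>b(x,y) = 0\<close>.\<close>

lemma form_Cauchy_Schwarz:
  assumes nonneg: "\<And>x. x \<in> ell2 \<Longrightarrow> 0 \<le> Re (b x x)" and x: "x \<in> ell2" and y: "y \<in> ell2"
  shows "(norm (b x y))\<^sup>2 \<le> Re (b x x) * Re (b y y)"
proof -
  define \<alpha> \<gamma> \<beta> where "\<alpha> = Re (b x x)" and "\<gamma> = Re (b y y)" and "\<beta> = b x y"
  have cx_re: "Re (complex_of_real c * z) = c * Re z" for c z by simp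
  have sq: "\<beta> * cnj \<beta> = complex_of_real ((norm \<beta>)\<^sup>2)" by (rule complex_norm_square[symmetric])
  have expand: "0 \<le> s\<^sup>2 * \<alpha> - 2 * s * r * (norm \<beta>)\<^sup>2 + r\<^sup>2 * (norm \<beta>)\<^sup>2 * \<gamma>" for s r :: real
  proof -
    let ?u = "\<lambda>n. complex_of_real s * x n" and ?v = "\<lambda>n. (complex_of_real r * \<beta>) * y n"
    have e: "?u \<in> ell2" "?v \<in> ell2" using x y by (auto intro: ell2_scale)
    have "b (\<lambda>n. ?u n - ?v n) (\<lambda>n. ?u n - ?v n) = (b ?u ?u - b ?u ?v) - (b ?v ?u - b ?v ?v)"
      using e by (simp add: form_diff_left form_diff_right ell2_diff)
    moreover have "b ?u ?u = complex_of_real (s\<^sup>2) * b x x"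
      using e x by (simp add: form_scale_left form_scale_right power2_eq_square)
    moreover have "b ?u ?v = complex_of_real (s * r * (norm \<beta>)\<^sup>2)"
    proof -
      have "b ?u ?v = complex_of_real s * (cnj (complex_of_real r * \<beta>) * \<beta>)"
        using e x y by (simp only: form_scale_left form_scale_right \<beta>_def)
      also have "\<dots> = complex_of_real (s * r) * (\<beta> * cnj \<beta>)" by simp
      finally show ?thesis by (simp only: sq of_real_mult)
    qed
    moreover have "b ?v ?u = cnj (b ?u ?v)" by (rule form_cnj) fact+
    moreover have "b ?v ?v = complex_of_real (r\<^sup>2 * (norm \<beta>)\<^sup>2) * b y y"
    proof -
      have "b ?v ?v = (complex_of_real r * \<beta>) * (cnj (complex_of_real r * \<beta>) * b y y)"
        using e y by (simp only: form_scale_left form_scale_right)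
      also have "\<dots> = complex_of_real (r * r) * (\<beta> * cnj \<beta>) * b y y" by simp
      finally show ?thesis by (simp only: sq of_real_mult power2_eq_square[of r])
    qed
    ultimately have "Re (b (\<lambda>n. ?u n - ?v n) (\<lambda>n. ?u n - ?v n)) =
        s\<^sup>2 * \<alpha> - 2 * s * r * (norm \<beta>)\<^sup>2 + r\<^sup>2 * (norm \<beta>)\<^sup>2 * \<gamma>"
      unfolding \<alpha>_def \<gamma>_def by (simp only: minus_complex.sel complex_cnj_complex_of_real Re_complex_of_real cx_re)
    moreover have "0 \<le> Re (b (\<lambda>n. ?u n - ?v n) (\<lambda>n. ?u n - ?v n))"
      using e by (intro nonneg ell2_diff)
    ultimately show ?thesis by (simp only:)
  qed
  have "\<alpha> \<ge> 0" "\<gamma> \<ge> 0" using nonneg x y by (auto simp: \<alpha>_def \<gamma>_def)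
  have "(norm \<beta>)\<^sup>2 \<le> \<alpha> * \<gamma>"
  proof (cases "\<gamma> = 0")
    case True
    have "2 * (norm \<beta>)\<^sup>2 * r \<le> \<alpha>" for r using expand[of 1 r] True by (simp add: algebra_simps)
    from this[of "(\<alpha> + 1) / (2 * (norm \<beta>)\<^sup>2)"] have "\<beta> = 0"
      by (cases "\<beta> = 0") simp_all
    with True show ?thesis by simp
  next
    case False
    then have "\<gamma> > 0" using \<open>\<gamma> \<ge> 0\<close> by simp
    have "0 \<le> \<gamma> * (\<gamma> * \<alpha> - (norm \<beta>)\<^sup>2)" using expand[of \<gamma> 1] by (simp add: algebra_simps power2_eq_square)
    then show ?thesis using \<open>\<gamma> > 0\<close> by (simp add: zero_le_mult_iff mult.commute)
  qed
  then show ?thesis by (simp add: \<alpha>_def \<gamma>_def \<beta>_def)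
qed

end

lemma hermitian_form_inner: "hermitian_form ell2_inner"
  unfolding hermitian_form_def
proof (intro conjI ballI allI)
  fix x y z :: "nat \<Rightarrow> complex" and c assume x: "x \<in> ell2" and z: "z \<in> ell2"
  show "ell2_inner (\<lambda>n. c * x n) z = c * ell2_inner x z"
    unfolding ell2_inner_def using summable_ell2_inner[OF x z]
    by (simp add: mult.assoc suminf_mult)
  show "ell2_inner z x = cnj (ell2_inner x z)"
  proof -
    have "(\<lambda>n. cnj (x n * cnj (z n))) sums cnj (ell2_inner x z)"
      unfolding ell2_inner_def sums_cnj using summable_ell2_inner[OF x z] by (rule summable_sums)
    then show ?thesis unfolding ell2_inner_def by (simp add: sums_iff mult.commute)
  qed
  assume y: "y \<in> ell2"
  show "ell2_inner (\<lambda>n. x n + y n) z = ell2_inner x z + ell2_inner y z"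
    unfolding ell2_inner_def using summable_ell2_inner[OF x z] summable_ell2_inner[OF y z]
    by (simp add: distrib_right suminf_add)
qed

lemmas inner_add_left = form_add_left[OF hermitian_form_inner]
  and inner_diff_left = form_diff_left[OF hermitian_form_inner]
  and inner_diff_right = form_diff_right[OF hermitian_form_inner]
  and inner_scale_left = form_scale_left[OF hermitian_form_inner]
  and inner_cnj = form_cnj[OF hermitian_form_inner]

lemma inner_self:
  assumes "x \<in> ell2" shows "ell2_inner x x = complex_of_real (\<Sum>n. (norm (x n))\<^sup>2)"
proof -
  have "(\<lambda>n. complex_of_real ((norm (x n))\<^sup>2)) sums complex_of_real (\<Sum>n. (norm (x n))\<^sup>2)"
    using assms unfolding ell2_def by (intro sums_of_real summable_sums) auto
  then show ?thesis unfolding ell2_inner_def complex_norm_square by (simp add: sums_iff)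
qed

lemma Re_inner_self: "x \<in> ell2 \<Longrightarrow> Re (ell2_inner x x) = (ell2_norm x)\<^sup>2"
  unfolding ell2_norm_def by (simp add: inner_self suminf_nonneg ell2_def)

lemma ell2_norm_nonneg: "x \<in> ell2 \<Longrightarrow> 0 \<le> ell2_norm x"
  unfolding ell2_norm_def by (simp add: suminf_nonneg ell2_def)

lemma ell2_norm_zero_iff:
  assumes "x \<in> ell2" shows "ell2_norm x = 0 \<longleftrightarrow> x = (\<lambda>n. 0)"
proof -
  have "summable (\<lambda>n. (norm (x n))\<^sup>2)" using assms by (simp add: ell2_def)
  from suminf_eq_zero_iff[OF this] show ?thesis by (simp add: ell2_norm_def fun_eq_iff)
qed

lemma inner_Cauchy_Schwarz:
  assumes "x \<in> ell2" "y \<in> ell2" shows "norm (ell2_inner x y) \<le> ell2_norm x * ell2_norm y"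
proof (rule power2_le_imp_le)
  show "(norm (ell2_inner x y))\<^sup>2 \<le> (ell2_norm x * ell2_norm y)\<^sup>2"
    using form_Cauchy_Schwarz[OF hermitian_form_inner _ assms] assms
    by (simp add: Re_inner_self power_mult_distrib)
qed (use assms in \<open>simp add: ell2_norm_nonneg\<close>)

lemma inner_unit_vec: "ell2_inner x (unit_vec j) = x j"
proof -
  have "ell2_inner x (unit_vec j) = (\<Sum>n\<in>{j}. x n * cnj (unit_vec j n))"
    unfolding ell2_inner_def by (rule suminf_finite) (auto simp: unit_vec_def)
  then show ?thesis by (simp add: unit_vec_def)
qed

lemma inner_zero_left: "ell2_inner (\<lambda>n. 0) y = 0"
  by (simp add: ell2_inner_def)

lemma inner_zero_right: "ell2_inner y (\<lambda>n. 0) = 0"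
  by (simp add: ell2_inner_def)

lemma ell2_norm_diff_truncation:
  assumes y: "y \<in> ell2"
  shows "(\<lambda>N. ell2_norm (\<lambda>n. y n - (if n < N then y n else 0))) \<longlonglongrightarrow> 0"
proof -
  let ?f = "\<lambda>n. (norm (y n))\<^sup>2"
  have s: "summable ?f" using y by (simp add: ell2_def)
  have "ell2_norm (\<lambda>n. y n - (if n < N then y n else 0)) = sqrt (suminf ?f - (\<Sum>n<N. ?f n))" for N
  proof -
    have "(\<lambda>n. if n \<in> {..<N} then ?f n else 0) sums (\<Sum>n<N. ?f n)"
      by (rule sums_If_finite_set) simp
    from sums_diff[OF summable_sums[OF s] this]
    have "(\<lambda>n. ?f n - (if n \<in> {..<N} then ?f n else 0)) sums (suminf ?f - (\<Sum>n<N. ?f n))" .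
    moreover have "(\<lambda>n. ?f n - (if n \<in> {..<N} then ?f n else 0)) =
        (\<lambda>n. (norm (y n - (if n < N then y n else 0)))\<^sup>2)" by auto
    ultimately show ?thesis unfolding ell2_norm_def by (simp add: sums_iff)
  qed
  moreover have "(\<lambda>N. sqrt (suminf ?f - (\<Sum>n<N. ?f n))) \<longlonglongrightarrow> sqrt (suminf ?f - suminf ?f)"
    by (intro tendsto_intros summable_LIMSEQ s)
  ultimately show ?thesis by simp
qed

text \<open>The Riesz representation of a bounded form by an operator, in coordinates: the vector that represents \<open>y \<mapsto> b(x,y)\<close> must have
the entries \<open>b x (unit_vec n)\<close>. Testing the form on the truncations of this vector bounds its norm by that of \<open>x\<close>.\<close>

lemma bounded_form_represented:
  assumes b: "hermitian_form b"
    and bound: "\<And>x y. x \<in> ell2 \<Longrightarrow> y \<in> ell2 \<Longrightarrow> norm (b x y) \<le> ell2_norm x * ell2_norm y"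
    and x: "x \<in> ell2"
  shows "(\<lambda>n. b x (unit_vec n)) \<in> ell2"
    and "y \<in> ell2 \<Longrightarrow> ell2_inner (\<lambda>n. b x (unit_vec n)) y = b x y"
proof -
  define g where "g n = b x (unit_vec n)" for n
  define trunc where "trunc N y = (\<lambda>n. if n < N then y n else 0)" for N and y :: "nat \<Rightarrow> complex"
  have trunc: "trunc N y \<in> ell2" for N y
    unfolding trunc_def by (rule ell2_finite_support[of N]) simp
  have b_trunc: "b x (trunc N y) = (\<Sum>n<N. g n * cnj (y n))" for N y
  proof (induction N)
    case 0
    have "b x (\<lambda>n. 0 * (\<lambda>n. 0 :: complex) n) = 0"
      by (subst form_scale_right[OF b x ell2_zero]) simp
    then show ?case by (simp add: trunc_def)
  next
    case (Suc N)
    have "trunc (Suc N) y = (\<lambda>n. trunc N y n + y N * unit_vec N n)"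
      by (auto simp: trunc_def unit_vec_def less_Suc_eq)
    then have "b x (trunc (Suc N) y) = b x (trunc N y) + cnj (y N) * b x (unit_vec N)"
      using form_add_right[OF b x trunc ell2_scale[OF unit_vec_ell2]] form_scale_right[OF b x unit_vec_ell2]
      by metis
    with Suc.IH show ?case by (simp add: g_def)
  qed
  have "(\<Sum>n<N. (norm (g n))\<^sup>2) \<le> (ell2_norm x)\<^sup>2" for N
  proof -
    define s where "s = (\<Sum>n<N. (norm (g n))\<^sup>2)"
    have s0: "s \<ge> 0" unfolding s_def by (intro sum_nonneg) simp
    have "b x (trunc N g) = complex_of_real s"
      unfolding b_trunc s_def of_real_sum complex_norm_square ..
    moreover have "ell2_norm (trunc N g) = sqrt s"
    proof -
      have "(\<lambda>n. if n \<in> {..<N} then (norm (g n))\<^sup>2 else 0) sums s"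
        unfolding s_def by (rule sums_If_finite_set) simp
      moreover have "(\<lambda>n. if n \<in> {..<N} then (norm (g n))\<^sup>2 else 0) = (\<lambda>n. (norm (trunc N g n))\<^sup>2)"
        by (auto simp: trunc_def)
      ultimately show ?thesis unfolding ell2_norm_def by (simp add: sums_iff)
    qed
    ultimately have "sqrt s * sqrt s \<le> ell2_norm x * sqrt s"
      using bound[OF x trunc, of N g] s0 by simp
    then have "sqrt s \<le> ell2_norm x"
    proof (cases "s = 0")
      case True then show ?thesis using ell2_norm_nonneg[OF x] by simp
    next
      case False
      then have "sqrt s > 0" using s0 by simp
      with \<open>sqrt s * sqrt s \<le> ell2_norm x * sqrt s\<close> show ?thesis by (rule mult_right_le_imp_le)
    qed
    then show ?thesis
      unfolding s_def[symmetric] by (rule sqrt_le_D)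
  qed
  then show g: "(\<lambda>n. b x (unit_vec n)) \<in> ell2"
    unfolding ell2_iff_bounded_sums g_def by blast
  assume y: "y \<in> ell2"
  have "(\<lambda>N. b x y - (\<Sum>n<N. g n * cnj (y n))) \<longlonglongrightarrow> 0"
  proof (rule Lim_null_comparison)
    show "\<forall>\<^sub>F N in sequentially. norm (b x y - (\<Sum>n<N. g n * cnj (y n))) \<le>
        ell2_norm x * ell2_norm (\<lambda>n. y n - trunc N y n)"
      unfolding b_trunc[symmetric] form_diff_right[OF b x y trunc, symmetric]
      by (intro always_eventually allI bound ell2_diff x y trunc)
    show "(\<lambda>N. ell2_norm x * ell2_norm (\<lambda>n. y n - trunc N y n)) \<longlonglongrightarrow> 0"
      unfolding trunc_def using tendsto_mult_left[OF ell2_norm_diff_truncation[OF y], of "ell2_norm x"] by simp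
  qed
  from tendsto_diff[OF tendsto_const[of "b x y"] this]
  have "(\<lambda>n. g n * cnj (y n)) sums b x y" by (simp add: sums_def)
  then show "ell2_inner (\<lambda>n. b x (unit_vec n)) y = b x y"
    unfolding ell2_inner_def g_def by (simp add: sums_iff)
qed

lemma scalar_measure_eqI:
  assumes "sets N = sets borel" "\<And>S. S \<in> sets borel \<Longrightarrow> emeasure N S = ennreal (Re (ell2_inner (E S x) x))"
  shows "scalar_measure E x = N"
proof -
  have "space N = UNIV" using sets_eq_imp_space_eq[OF assms(1)] by simp
  have "scalar_measure E x = measure_of UNIV (sets borel) (emeasure N)"
    unfolding scalar_measure_def by (rule measure_of_eq) (use assms sets.sigma_sets_eq[of "borel :: real measure"] in auto)
  also have "\<dots> = measure_of (space N) (sets N) (emeasure N)"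
    using \<open>space N = UNIV\<close> assms(1) by simp
  finally show ?thesis by (simp only: measure_of_of_measure)
qed

section \<open>The spectral theorem for operators between 0 and 1\<close>

text \<open>The name is that of quantum theory for operators between 0 and 1. This normalization puts the measures to be constructed on
\<open>[0,1]\<close>, the interval of Hausdorff's theorem.\<close>

locale ell2_effect =
  fixes A :: "(nat \<Rightarrow> complex) \<Rightarrow> (nat \<Rightarrow> complex)"
  assumes closed: "x \<in> ell2 \<Longrightarrow> A x \<in> ell2"
    and additive: "x \<in> ell2 \<Longrightarrow> y \<in> ell2 \<Longrightarrow> A (\<lambda>n. x n + y n) = (\<lambda>n. A x n + A y n)"
    and homogeneous: "x \<in> ell2 \<Longrightarrow> A (\<lambda>n. c * x n) = (\<lambda>n. c * A x n)"
    and symmetric: "x \<in> ell2 \<Longrightarrow> y \<in> ell2 \<Longrightarrow> ell2_inner (A x) y = ell2_inner x (A y)"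
    and nonneg: "x \<in> ell2 \<Longrightarrow> 0 \<le> Re (ell2_inner (A x) x)"
    and le_one: "x \<in> ell2 \<Longrightarrow> Re (ell2_inner (A x) x) \<le> Re (ell2_inner x x)"
begin

definition C :: "(nat \<Rightarrow> complex) \<Rightarrow> (nat \<Rightarrow> complex)" where "C x = (\<lambda>n. x n - A x n)"

lemma C_closed: "x \<in> ell2 \<Longrightarrow> C x \<in> ell2"
  unfolding C_def by (intro ell2_diff closed)

lemma pow_closed: "x \<in> ell2 \<Longrightarrow> (A ^^ k) x \<in> ell2"
  by (induction k) (auto intro: closed)

lemma C_pow_closed: "x \<in> ell2 \<Longrightarrow> (C ^^ k) x \<in> ell2"
  by (induction k) (auto intro: C_closed)

lemma pow_additive:
  "x \<in> ell2 \<Longrightarrow> y \<in> ell2 \<Longrightarrow> (A ^^ k) (\<lambda>n. x n + y n) = (\<lambda>n. (A ^^ k) x n + (A ^^ k) y n)"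
  by (induction k) (simp_all add: additive pow_closed)

lemma pow_homogeneous: "x \<in> ell2 \<Longrightarrow> (A ^^ k) (\<lambda>n. c * x n) = (\<lambda>n. c * (A ^^ k) x n)"
  by (induction k) (simp_all add: homogeneous pow_closed)

lemma pow_difference:
  assumes "x \<in> ell2" "y \<in> ell2"
  shows "(A ^^ k) (\<lambda>n. x n - y n) = (\<lambda>n. (A ^^ k) x n - (A ^^ k) y n)"
  using pow_additive[OF assms(1) ell2_scale[OF assms(2)], of k "-1"] pow_homogeneous[OF assms(2), of k "-1"]
  by simp

lemma pow_symmetric:
  "x \<in> ell2 \<Longrightarrow> y \<in> ell2 \<Longrightarrow> ell2_inner ((A ^^ k) x) y = ell2_inner x ((A ^^ k) y)"
proof (induction k arbitrary: y)
  case (Suc k)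
  have "ell2_inner ((A ^^ Suc k) x) y = ell2_inner ((A ^^ k) x) (A y)"
    using Suc.prems by (simp add: symmetric pow_closed)
  also have "\<dots> = ell2_inner x ((A ^^ k) (A y))" using Suc by (simp add: closed)
  finally show ?case by (simp add: funpow_swap1)
qed simp

lemma C_symmetric: "x \<in> ell2 \<Longrightarrow> y \<in> ell2 \<Longrightarrow> ell2_inner (C x) y = ell2_inner x (C y)"
  unfolding C_def by (simp add: inner_diff_left inner_diff_right closed symmetric)

lemma C_pow_commute: "y \<in> ell2 \<Longrightarrow> C ((A ^^ i) y) = (A ^^ i) (C y)"
  using pow_difference[of y "A y" i] unfolding C_def by (simp add: closed funpow_swap1)

lemma A_C_pow_commute: "x \<in> ell2 \<Longrightarrow> A ((C ^^ m) x) = (C ^^ m) (A x)"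
proof (induction m)
  case (Suc m)
  then show ?case using C_pow_commute[OF C_pow_closed, of x 1 m] by simp
qed simp

text \<open>Two factors \<open>A\<close>, or two factors \<open>C = 1 - A\<close>, can be moved symmetrically to both sides of the inner product, because all factors
commute. This leaves exponents at most 1, where the only case of interest is
\<open>A C = C A C + A C A\<close>, a consequence of \<open>A + C = 1\<close>.\<close>

lemma pow_C_pow_nonneg: "x \<in> ell2 \<Longrightarrow> 0 \<le> Re (ell2_inner ((A ^^ i) ((C ^^ m) x)) x)"
proof (induction "i + m" arbitrary: i m x rule: less_induct)
  case less
  note x = less.prems
  consider i' where "i = Suc (Suc i')" | m' where "m = Suc (Suc m')"
    | "i = 0" "m = 0" | "i = 1" "m = 0" | "i = 0" "m = 1" | "i = 1" "m = 1"
  proof -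
    have "(\<exists>k. n = Suc (Suc k)) \<or> n = 0 \<or> n = 1" for n :: nat by presburger
    from this[of i] this[of m] show thesis using that by blast
  qed
  then show ?case
  proof cases
    case (1 i')
    have "(A ^^ i) ((C ^^ m) x) = A ((A ^^ i') ((C ^^ m) (A x)))"
      unfolding 1 using A_C_pow_commute[OF x, of m] by (simp add: funpow_swap1)
    then have "ell2_inner ((A ^^ i) ((C ^^ m) x)) x = ell2_inner ((A ^^ i') ((C ^^ m) (A x))) (A x)"
      using x by (simp add: symmetric pow_closed C_pow_closed closed)
    then show ?thesis using less.hyps[of i' m "A x"] x 1 by (simp add: closed)
  next
    case (2 m')
    have "(A ^^ i) ((C ^^ m) x) = C ((A ^^ i) ((C ^^ m') (C x)))"
      unfolding 2 using C_pow_commute[of "(C ^^ Suc m') x" i] x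
      by (simp add: funpow_swap1 C_pow_closed C_closed)
    then have "ell2_inner ((A ^^ i) ((C ^^ m) x)) x = ell2_inner ((A ^^ i) ((C ^^ m') (C x))) (C x)"
      using x by (simp add: C_symmetric pow_closed C_pow_closed C_closed)
    then show ?thesis using less.hyps[of i m' "C x"] x 2 by (simp add: C_closed)
  next
    case 3 then show ?thesis using x by (simp add: Re_inner_self)
  next
    case 4 then show ?thesis using nonneg[OF x] by simp
  next
    case 5 then show ?thesis using le_one[OF x] x by (simp add: C_def inner_diff_left closed)
  next
    case 6
    have AC: "A (C y) = C (A y)" if "y \<in> ell2" for y using C_pow_commute[OF that, of 1] by simp
    have "A (C x) = (\<lambda>n. A (C (A x)) n + A (C (C x)) n)"
    proof -
      have "C x = (\<lambda>n. C (A x) n + C (C x) n)"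
        using pow_difference[of x "A x" 1] x by (simp add: C_def closed)
      then have "A (C x) = A (\<lambda>n. C (A x) n + C (C x) n)" by (rule arg_cong)
      then show ?thesis using x by (simp only: additive closed C_closed)
    qed
    then have "ell2_inner (A (C x)) x = ell2_inner (\<lambda>n. A (C (A x)) n + A (C (C x)) n) x"
      by (rule arg_cong)
    also have "\<dots> = ell2_inner (A (C (A x))) x + ell2_inner (A (C (C x))) x"
      using x by (intro inner_add_left closed C_closed)
    also have "ell2_inner (A (C (A x))) x = ell2_inner (C (A x)) (A x)"
      using x by (simp add: symmetric closed C_closed)
    also have "ell2_inner (A (C (C x))) x = ell2_inner (A (C x)) (C x)"
      using x by (simp add: AC C_symmetric closed C_closed)
    finally have "ell2_inner (A (C x)) x = ell2_inner (C (A x)) (A x) + ell2_inner (A (C x)) (C x)" .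
    moreover have "0 \<le> Re (ell2_inner (C (A x)) (A x))"
      using le_one[of "A x"] x by (simp add: C_def inner_diff_left closed)
    ultimately show ?thesis using 6 nonneg[of "C x"] x by (simp add: C_closed)
  qed
qed

text \<open>Hausdorff's theorem for \<open>w i m = \<langle>A\<^sup>i (1 - A)\<^sup>m x, x\<rangle>\<close>; its recursion is \<open>A + (1 - A) = 1\<close>.\<close>

lemma moment_representation:
  assumes x: "x \<in> ell2"
  shows "\<exists>\<rho>. real_distribution \<rho> \<and> (AE t in \<rho>. t \<in> {0..1}) \<and>
    (\<forall>k. Re (ell2_inner ((A ^^ k) x) x) = Re (ell2_inner x x) * (\<integral>t. t ^ k \<partial>\<rho>))"
proof -
  define w where "w i m = Re (ell2_inner ((A ^^ i) ((C ^^ m) x)) x)" for i m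
  have "w i m = w (Suc i) m + w i (Suc m)" for i m
  proof -
    let ?z = "(C ^^ m) x"
    have "(C ^^ Suc m) x = (\<lambda>n. ?z n - A ?z n)" by (simp add: C_def)
    then have "(A ^^ i) ((C ^^ Suc m) x) = (\<lambda>n. (A ^^ i) ?z n - (A ^^ Suc i) ?z n)"
      using pow_difference[of ?z "A ?z" i] x by (simp add: C_pow_closed closed funpow_swap1)
    then show ?thesis
      unfolding w_def using x
      by (simp add: inner_diff_left pow_closed C_pow_closed closed del: funpow.simps)
  qed
  moreover have "0 \<le> w i m" for i m unfolding w_def by (rule pow_C_pow_nonneg[OF x])
  ultimately show ?thesis using Hausdorff_moment_problem[of w] by (simp add: w_def)
qed

definition \<rho> :: "(nat \<Rightarrow> complex) \<Rightarrow> real measure" where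
  "\<rho> x = (SOME \<rho>. real_distribution \<rho> \<and> (AE t in \<rho>. t \<in> {0..1}) \<and>
    (\<forall>k. Re (ell2_inner ((A ^^ k) x) x) = Re (ell2_inner x x) * (\<integral>t. t ^ k \<partial>\<rho>)))"

lemma
  assumes "x \<in> ell2"
  shows \<rho>_distribution: "real_distribution (\<rho> x)"
    and \<rho>_support: "AE t in \<rho> x. t \<in> {0..1}"
    and \<rho>_moment: "Re (ell2_inner ((A ^^ k) x) x) = Re (ell2_inner x x) * (\<integral>t. t ^ k \<partial>\<rho> x)"
  using someI_ex[OF moment_representation[OF assms]] unfolding \<rho>_def by blast+

definition quad :: "(nat \<Rightarrow> complex) \<Rightarrow> (real \<Rightarrow> real) \<Rightarrow> complex" where
  "quad x f = complex_of_real (Re (ell2_inner x x)) * complex_of_real (\<integral>t. f t \<partial>\<rho> x)"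

text \<open>The polarization of the measures \<open>quad x\<close>: \<open>form f x y\<close> is meant to be \<open>\<langle>f(A) x, y\<rangle>\<close>.\<close>

definition form :: "(real \<Rightarrow> real) \<Rightarrow> (nat \<Rightarrow> complex) \<Rightarrow> (nat \<Rightarrow> complex) \<Rightarrow> complex" where
  "form f x y = (1/4) * ((quad (\<lambda>n. x n + y n) f - quad (\<lambda>n. x n - y n) f) +
     \<i> * (quad (\<lambda>n. x n + \<i> * y n) f - quad (\<lambda>n. x n - \<i> * y n) f))"

lemma sigma_functional_quad: "x \<in> ell2 \<Longrightarrow> sigma_functional (quad x)"
  unfolding quad_def
  by (intro sigma_functional_times sigma_functional_integral \<rho>_distribution \<rho>_support)

lemma sigma_functional_form: "x \<in> ell2 \<Longrightarrow> y \<in> ell2 \<Longrightarrow> sigma_functional (\<lambda>f. form f x y)"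
  unfolding form_def
  by (intro sigma_functional_times sigma_functional_plus sigma_functional_minus sigma_functional_quad
      ell2_add ell2_diff ell2_scale)

lemma quad_moment: "x \<in> ell2 \<Longrightarrow> quad x (\<lambda>t. t ^ k) = complex_of_real (Re (ell2_inner ((A ^^ k) x) x))"
  unfolding quad_def by (simp add: \<rho>_moment)

lemma hermitian_form_pow: "hermitian_form (\<lambda>x y. ell2_inner ((A ^^ k) x) y)"
  unfolding hermitian_form_def
proof (intro conjI allI ballI)
  fix x y assume "x \<in> ell2" "y \<in> ell2"
  then show "ell2_inner ((A ^^ k) y) x = cnj (ell2_inner ((A ^^ k) x) y)"
    using inner_cnj[of "(A ^^ k) x" y] pow_symmetric[of y x k] by (simp add: pow_closed)
qed (simp_all add: pow_additive pow_homogeneous inner_add_left inner_scale_left pow_closed)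

text \<open>On powers of the variable the polarized integral is the functional calculus that one wants. By the uniqueness of functionals
with given moments, every algebraic property of the powers of \<open>A\<close> passes to indicators of Borel sets.\<close>

lemma form_moment: "x \<in> ell2 \<Longrightarrow> y \<in> ell2 \<Longrightarrow> form (\<lambda>t. t ^ k) x y = ell2_inner ((A ^^ k) x) y"
  unfolding form_def
  by (subst form_polarization[OF hermitian_form_pow])
    (simp_all add: quad_moment ell2_add ell2_diff ell2_scale)

lemma form_diagonal:
  assumes "x \<in> ell2" "S \<in> sets borel" shows "form (indicator S) x x = quad x (indicator S)"
  by (rule sigma_functional_determined_by_moments[OF sigma_functional_form sigma_functional_quad])
    (use assms in \<open>simp_all add: form_moment quad_moment form_diagonal_real[OF hermitian_form_pow, symmetric]\<close>)

text \<open>Each law equates two functionals whose moments are \<open>\<langle>A\<^sup>k x, y\<rangle>\<close> at the arguments in question, and these moments obey the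
law.\<close>

lemma hermitian_form_indicator:
  assumes S: "S \<in> sets borel" shows "hermitian_form (form (indicator S))"
  unfolding hermitian_form_def
proof (intro conjI allI ballI)
  fix x z :: "nat \<Rightarrow> complex" and c assume x: "x \<in> ell2" and z: "z \<in> ell2"
  show "form (indicator S) (\<lambda>n. c * x n) z = c * form (indicator S) x z"
    by (rule sigma_functional_determined_by_moments[OF sigma_functional_form
          sigma_functional_times[OF sigma_functional_form] _ S])
      (use x z form_scale_left[OF hermitian_form_pow] in \<open>simp_all add: form_moment ell2_scale\<close>)
  show "form (indicator S) z x = cnj (form (indicator S) x z)"
    by (rule sigma_functional_determined_by_moments[OF sigma_functional_form
          sigma_functional_cnj[OF sigma_functional_form] _ S])
      (use x z form_cnj[OF hermitian_form_pow, of x z] in \<open>simp_all add: form_moment\<close>)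
  fix y assume y: "y \<in> ell2"
  show "form (indicator S) (\<lambda>n. x n + y n) z = form (indicator S) x z + form (indicator S) y z"
    by (rule sigma_functional_determined_by_moments[OF sigma_functional_form
          sigma_functional_plus[OF sigma_functional_form sigma_functional_form] _ S])
      (use x y z form_add_left[OF hermitian_form_pow] in \<open>simp_all add: form_moment ell2_add\<close>)
qed

lemma form_indicator_diagonal:
  assumes "x \<in> ell2" "S \<in> sets borel"
  shows "form (indicator S) x x = complex_of_real (Re (ell2_inner x x) * measure (\<rho> x) S)"
proof -
  interpret real_distribution "\<rho> x" by (rule \<rho>_distribution) fact
  show ?thesis using assms by (simp add: form_diagonal quad_def)
qed

lemma form_indicator_bound:
  assumes S: "S \<in> sets borel" and x: "x \<in> ell2" and y: "y \<in> ell2"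
  shows "norm (form (indicator S) x y) \<le> ell2_norm x * ell2_norm y"
proof (rule power2_le_imp_le)
  have d: "0 \<le> Re (form (indicator S) z z) \<and> Re (form (indicator S) z z) \<le> (ell2_norm z)\<^sup>2" if "z \<in> ell2" for z
  proof -
    interpret real_distribution "\<rho> z" by (rule \<rho>_distribution) fact
    show ?thesis using that S by (simp add: form_indicator_diagonal Re_inner_self mult_left_le)
  qed
  have "(norm (form (indicator S) x y))\<^sup>2 \<le> Re (form (indicator S) x x) * Re (form (indicator S) y y)"
    using form_Cauchy_Schwarz[OF hermitian_form_indicator[OF S] _ x y] d by blast
  also have "\<dots> \<le> (ell2_norm x)\<^sup>2 * (ell2_norm y)\<^sup>2"
    using d x y by (intro mult_mono) auto
  finally show "(norm (form (indicator S) x y))\<^sup>2 \<le> (ell2_norm x * ell2_norm y)\<^sup>2"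
    by (simp add: power_mult_distrib)
qed (use x y in \<open>simp add: ell2_norm_nonneg\<close>)

definition E :: "real set \<Rightarrow> (nat \<Rightarrow> complex) \<Rightarrow> (nat \<Rightarrow> complex)" where
  "E S x = (\<lambda>n. form (indicator S) x (unit_vec n))"

lemma E_closed: "S \<in> sets borel \<Longrightarrow> x \<in> ell2 \<Longrightarrow> E S x \<in> ell2"
  unfolding E_def
  by (rule bounded_form_represented(1)[OF hermitian_form_indicator form_indicator_bound])

lemma inner_E: "S \<in> sets borel \<Longrightarrow> x \<in> ell2 \<Longrightarrow> y \<in> ell2 \<Longrightarrow> ell2_inner (E S x) y = form (indicator S) x y"
  unfolding E_def
  by (rule bounded_form_represented(2)[OF hermitian_form_indicator form_indicator_bound])

lemma E_symmetric:
  assumes "S \<in> sets borel" "x \<in> ell2" "y \<in> ell2"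
  shows "ell2_inner (E S x) y = ell2_inner x (E S y)"
  using assms inner_cnj[OF E_closed[OF assms(1,3)] assms(2)] form_cnj[OF hermitian_form_indicator[OF assms(1)] assms(3,2)]
  by (simp add: inner_E)

text \<open>Multiplicativity takes two applications of uniqueness. For a fixed Borel set \<open>S\<close>, comparing
\<open>f \<mapsto> form (t\<^sup>k f) x y\<close> with \<open>f \<mapsto> form f (A\<^sup>k x) y\<close> gives \<open>form (t\<^sup>k 1\<^sub>S) x y = \<langle>E(S) A\<^sup>k x, y\<rangle>
= \<langle>A\<^sup>k x, E(S) y\<rangle>\<close>. These are the moments of \<open>f \<mapsto> form f x (E(S) y)\<close>, so the latter agrees with
\<open>f \<mapsto> form (1\<^sub>S f) x y\<close> on the indicator of \<open>T\<close>.\<close>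

lemma E_inter:
  assumes S: "S \<in> sets borel" and T: "T \<in> sets borel" and x: "x \<in> ell2"
  shows "E (S \<inter> T) x = E S (E T x)"
proof
  fix n
  let ?y = "unit_vec n"
  have y: "?y \<in> ell2" by (rule unit_vec_ell2)
  have 1: "form (\<lambda>t. t ^ k * indicator S t) x ?y = form (indicator S) ((A ^^ k) x) ?y" for k
    by (rule sigma_functional_determined_by_moments[OF
          sigma_functional_weight[OF sigma_functional_form unit_bounded_power] sigma_functional_form _ S])
      (use x y in \<open>simp_all add: pow_closed form_moment funpow_add add.commute flip: power_add\<close>)
  have "form (\<lambda>t. indicator S t * indicator T t) x ?y = form (indicator T) x (E S ?y)"
  proof (rule sigma_functional_determined_by_moments[OF
          sigma_functional_weight[OF sigma_functional_form unit_bounded_indicator[OF S]] sigma_functional_form _ T])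
    fix k
    have "form (\<lambda>t. indicator S t * t ^ k) x ?y = form (indicator S) ((A ^^ k) x) ?y"
      using 1[of k] by (simp add: mult.commute)
    also have "\<dots> = ell2_inner ((A ^^ k) x) (E S ?y)"
      using x y S by (simp add: inner_E[symmetric] E_symmetric pow_closed)
    finally show "form (\<lambda>t. indicator S t * t ^ k) x ?y = form (\<lambda>t. t ^ k) x (E S ?y)"
      using x y S by (simp add: form_moment E_closed)
  qed (use x y S in \<open>auto intro: E_closed\<close>)
  also have "\<dots> = ell2_inner (E S (E T x)) ?y"
    using x y S T by (simp add: inner_E[symmetric] E_symmetric E_closed)
  finally show "E (S \<inter> T) x n = E S (E T x) n"
    by (simp add: inner_unit_vec) (simp add: E_def indicator_inter_arith[symmetric, abs_def])
qed

lemma E_total: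
  assumes S: "S \<in> sets borel" "{0..1} \<subseteq> S" and x: "x \<in> ell2" shows "E S x = x"
proof
  fix n
  have "form (indicator S) x (unit_vec n) = form (\<lambda>t. t ^ 0) x (unit_vec n)"
    by (rule sigma_functional_cong[OF sigma_functional_form[OF x unit_vec_ell2] unit_bounded_indicator[OF S(1)]])
      (use S in \<open>auto simp: indicator_def\<close>)
  also have "\<dots> = x n"
    using x by (subst form_moment) (simp_all add: unit_vec_ell2 inner_unit_vec)
  finally show "E S x n = x n" by (simp add: E_def)
qed

lemma orthogonal_projection_E:
  assumes S: "S \<in> sets borel" shows "orthogonal_projection (E S)"
proof -
  have "ell2_norm (E S x) \<le> 1 * ell2_norm x" if x: "x \<in> ell2" for x
  proof -
    have "(ell2_norm (E S x))\<^sup>2 = Re (form (indicator S) x (E S x))"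
      using S x by (simp add: Re_inner_self[symmetric] inner_E E_closed)
    also have "\<dots> \<le> ell2_norm x * ell2_norm (E S x)"
      using form_indicator_bound[OF S x E_closed[OF S x]] complex_Re_le_cmod order_trans by blast
    finally have *: "ell2_norm (E S x) * ell2_norm (E S x) \<le> ell2_norm x * ell2_norm (E S x)"
      by (simp add: power2_eq_square)
    show ?thesis
    proof (cases "ell2_norm (E S x) = 0")
      case True then show ?thesis using ell2_norm_nonneg[OF x] by simp
    next
      case False
      then have "ell2_norm (E S x) > 0" using ell2_norm_nonneg[OF E_closed[OF S x]] by simp
      with * show ?thesis by simp
    qed
  qed
  then show ?thesis
    unfolding orthogonal_projection_def bounded_operator_def
    using E_closed[OF S] E_inter[OF S S] E_symmetric[OF S]
      form_add_left[OF hermitian_form_indicator[OF S] _ _ unit_vec_ell2]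
      form_scale_left[OF hermitian_form_indicator[OF S] _ unit_vec_ell2]
    by (intro conjI ballI allI exI[of _ "1::real"]) (simp_all add: E_def)
qed

text \<open>The remainder after \<open>N\<close> terms is the projection of the remaining set \<open>R N\<close>. Its squared norm at \<open>x\<close> is the measure of
\<open>R N\<close> for the single vector \<open>x\<close>, which tends to 0.\<close>

lemma E_countably_additive:
  fixes S :: "nat \<Rightarrow> real set"
  assumes S: "range S \<subseteq> sets borel" and disj: "disjoint_family S" and x: "x \<in> ell2"
  shows "(\<lambda>N. ell2_norm (\<lambda>n. E (\<Union>i. S i) x n - (\<Sum>i<N. E (S i) x n))) \<longlonglongrightarrow> 0"
proof -
  define R where "R N = (\<Union>i. S i) - (\<Union>i<N. S i)" for N
  have Sb: "S i \<in> sets borel" for i using S by auto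
  have Rb: "R N \<in> sets borel" for N unfolding R_def using Sb by auto
  have ind: "indicator (R N) t = (indicator (\<Union>i. S i) t - (\<Sum>i<N. indicator (S i) t) :: real)" for N t
  proof -
    have "(\<Sum>i<N. indicator (S i) t) = (indicator (\<Union>i<N. S i) t :: real)"
      using disj by (subst indicator_UN_disjoint) (auto simp: disjoint_family_on_def)
    then show ?thesis by (auto simp: R_def indicator_def)
  qed
  have "E (\<Union>i. S i) x n - (\<Sum>i<N. E (S i) x n) = E (R N) x n" for n N
  proof -
    note F = sigma_functional_form[OF x unit_vec_ell2[of n]]
    have "form (\<lambda>t. indicator (\<Union>i. S i) t - (\<Sum>i<N. indicator (S i) t)) x (unit_vec n) =
        form (indicator (\<Union>i. S i)) x (unit_vec n) - form (\<lambda>t. \<Sum>i<N. indicator (S i) t) x (unit_vec n)"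
      by (rule sigma_functional_diff[OF F])
        (intro unit_bounded_indicator unit_bounded_sum sets.countable_UN S Sb)+
    also have "form (\<lambda>t. \<Sum>i<N. indicator (S i) t) x (unit_vec n) = (\<Sum>i<N. form (indicator (S i)) x (unit_vec n))"
      by (rule sigma_functional_sum[OF F]) (intro unit_bounded_indicator Sb)
    finally show ?thesis by (simp add: E_def ind[abs_def])
  qed
  moreover have "(\<lambda>N. ell2_norm (E (R N) x)) \<longlonglongrightarrow> 0"
  proof -
    have "(ell2_norm (E (R N) x))\<^sup>2 = Re (quad x (indicator (R N)))" for N
    proof -
      have "ell2_inner (E (R N) x) (E (R N) x) = ell2_inner (E (R N) (E (R N) x)) x"
        using x Rb by (simp add: E_symmetric E_closed)
      also have "E (R N) (E (R N) x) = E (R N) x" using E_inter[OF Rb Rb x, of N N] by simp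
      finally show ?thesis
        using x Rb by (simp add: Re_inner_self[symmetric] E_closed inner_E form_diagonal)
    qed
    then have "ell2_norm (E (R N) x) = sqrt (Re (quad x (indicator (R N))))" for N
      using ell2_norm_nonneg[OF E_closed[OF Rb x]] real_sqrt_unique by metis
    moreover have "(\<lambda>N. quad x (indicator (R N))) \<longlonglongrightarrow> quad x (\<lambda>t. 0)"
    proof (rule sigma_functional_tendsto[OF sigma_functional_quad[OF x], where C = 1])
      show "(\<lambda>N. indicator (R N) t :: real) \<longlonglongrightarrow> 0" for t
        using tendsto_diff[OF tendsto_const indicator_sums[of S t, unfolded sums_def], of "indicator (\<Union>i. S i) t"] disj
        unfolding ind disjoint_family_on_def by auto
    qed (use Rb in \<open>auto simp: indicator_def\<close>)
    then have "(\<lambda>N. sqrt (Re (quad x (indicator (R N))))) \<longlonglongrightarrow> sqrt (Re 0)"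
      using sigma_functional_zero[OF sigma_functional_quad[OF x]] by (intro tendsto_intros) simp
    ultimately show ?thesis by simp
  qed
  ultimately show ?thesis by simp
qed

text \<open>The spectral theorem for affine images of \<open>A\<close>, which by rescaling are all bounded self-adjoint operators. The spectral measure
is transported along the affine map.\<close>

theorem spectral_measure_affine:
  assumes T: "\<And>x. x \<in> ell2 \<Longrightarrow> T x = (\<lambda>n. complex_of_real \<alpha> * A x n + complex_of_real \<beta> * x n)"
  shows "is_spectral_measure T (\<lambda>S. E ((\<lambda>s. \<alpha> * s + \<beta>) -` S))"
proof -
  define h where "h s = \<alpha> * s + \<beta>" for s
  have hm[measurable]: "h \<in> borel_measurable borel" unfolding h_def by measurable
  have hb: "h -` S \<in> sets borel" if "S \<in> sets borel" for S
    using measurable_sets_borel[OF hm that] by simp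
  have "projection_valued_measure (\<lambda>S. E (h -` S))"
    unfolding projection_valued_measure_def
  proof (intro conjI ballI allI impI)
    fix S :: "real set" assume "S \<in> sets borel" then show "orthogonal_projection (E (h -` S))"
      by (intro orthogonal_projection_E hb)
  next
    fix x :: "nat \<Rightarrow> complex" assume "x \<in> ell2"
    then show "E (h -` {}) x = (\<lambda>n. 0)"
      using sigma_functional_zero[OF sigma_functional_form[OF _ unit_vec_ell2]]
      by (simp add: E_def indicator_def[abs_def])
  next
    fix x :: "nat \<Rightarrow> complex" assume "x \<in> ell2" then show "E (h -` UNIV) x = x" by (simp add: E_total)
  next
    fix S T :: "real set" and x :: "nat \<Rightarrow> complex"
    assume "S \<in> sets borel" "T \<in> sets borel" "x \<in> ell2"
    then show "E (h -` (S \<inter> T)) x = E (h -` S) (E (h -` T) x)" by (simp add: vimage_Int E_inter hb)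
  next
    fix S :: "nat \<Rightarrow> real set" and x :: "nat \<Rightarrow> complex"
    assume S: "range S \<subseteq> sets borel" and d: "disjoint_family S" and x: "x \<in> ell2"
    have "range (\<lambda>i. h -` S i) \<subseteq> sets borel" using S hb by auto
    moreover have "disjoint_family (\<lambda>i. h -` S i)" using d by (auto simp: disjoint_family_on_def)
    ultimately show "(\<lambda>N. ell2_norm (\<lambda>n. E (h -` (\<Union>i. S i)) x n - (\<Sum>i<N. E (h -` S i) x n))) \<longlonglongrightarrow> 0"
      unfolding vimage_UN using E_countably_additive[OF _ _ x] by blast
  qed
  moreover have "\<forall>x\<in>ell2. E (h -` {-(\<bar>\<alpha>\<bar> + \<bar>\<beta>\<bar>)..\<bar>\<alpha>\<bar> + \<bar>\<beta>\<bar>}) x = x"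
  proof (intro ballI E_total hb)
    have "\<bar>h s\<bar> \<le> \<bar>\<alpha>\<bar> + \<bar>\<beta>\<bar>" if "s \<in> {0..1}" for s
    proof -
      have "\<bar>\<alpha> * s\<bar> \<le> \<bar>\<alpha>\<bar>" unfolding abs_mult using that by (intro mult_left_le) auto
      then show ?thesis unfolding h_def by linarith
    qed
    then show "{0..1} \<subseteq> h -` {-(\<bar>\<alpha>\<bar> + \<bar>\<beta>\<bar>)..\<bar>\<alpha>\<bar> + \<bar>\<beta>\<bar>}" by (auto simp: abs_le_iff) (smt (verit))
  qed auto
  moreover have "ell2_inner (T x) x = complex_of_real (LINT t|scalar_measure (\<lambda>S. E (h -` S)) x. t)" if x: "x \<in> ell2" for x
  proof -
    interpret real_distribution "\<rho> x" by (rule \<rho>_distribution) fact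
    define r where "r = Re (ell2_inner x x)"
    have r0: "r \<ge> 0" using x by (simp add: r_def Re_inner_self)
    let ?N = "distr (density (\<rho> x) (\<lambda>_. ennreal r)) borel h"
    have N: "scalar_measure (\<lambda>S. E (h -` S)) x = ?N"
    proof (rule scalar_measure_eqI)
      fix S :: "real set" assume S: "S \<in> sets borel"
      have "emeasure ?N S = ennreal r * emeasure (\<rho> x) (h -` S)"
        using hb[OF S] S by (simp add: emeasure_distr emeasure_density nn_integral_cmult_indicator)
      also have "\<dots> = ennreal (r * measure (\<rho> x) (h -` S))"
        using r0 by (simp add: emeasure_eq_measure ennreal_mult)
      finally show "emeasure ?N S = ennreal (Re (ell2_inner (E (h -` S) x) x))"
        using hb[OF S] x by (simp add: inner_E form_indicator_diagonal r_def)
    qed simp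
    have int: "integrable (\<rho> x) (\<lambda>t. t)"
      by (rule integrable_const_bound[where B = 1])
        (use \<rho>_support[OF x] in \<open>auto elim: eventually_mono\<close>)
    have "(LINT t|?N. t) = (\<integral>s. r * h s \<partial>\<rho> x)"
      using r0 by (simp add: integral_distr integral_density)
    also have "\<dots> = r * (\<alpha> * (\<integral>s. s \<partial>\<rho> x) + \<beta>)"
      using int prob_space by (simp add: h_def)
    also have "\<dots> = \<alpha> * Re (ell2_inner (A x) x) + \<beta> * r"
      using \<rho>_moment[OF x, of 1] by (simp add: r_def algebra_simps)
    finally have "complex_of_real (LINT t|?N. t) = complex_of_real \<alpha> * complex_of_real (Re (ell2_inner (A x) x)) + complex_of_real \<beta> * complex_of_real r"
      by simp
    also have "complex_of_real (Re (ell2_inner (A x) x)) = ell2_inner (A x) x"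
      using form_diagonal_real[OF hermitian_form_pow[of 1] x] by simp
    also have "complex_of_real r = ell2_inner x x"
      using form_diagonal_real[OF hermitian_form_inner x] by (simp add: r_def)
    finally show ?thesis
      unfolding N T[OF x] using x by (simp add: inner_add_left inner_scale_left closed ell2_scale)
  qed
  ultimately show ?thesis unfolding is_spectral_measure_def h_def by blast
qed

end

section \<open>The projection of a spectral measure onto a point\<close>

text \<open>Polarization once more: if the diagonal does not distinguish \<open>y + c z\<close> from \<open>y - c z\<close>, then \<open>c = 1\<close> and \<open>c = \<i>\<close> show that real
and imaginary part of the form vanish at \<open>(y, z)\<close>.\<close>

lemma form_eq_zeroI:
  assumes b: "hermitian_form b" and y: "y \<in> ell2" and z: "z \<in> ell2"
    and eq: "\<And>c. b (\<lambda>n. y n + c * z n) (\<lambda>n. y n + c * z n) = b (\<lambda>n. y n - c * z n) (\<lambda>n. y n - c * z n)"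
  shows "b y z = 0"
proof -
  have "Re (b y (\<lambda>n. c * z n)) = 0" for c
    using form_sum_minus_difference[OF b y ell2_scale[OF z], of c] eq[of c] by simp
  then have "Re (cnj c * b y z) = 0" for c
    by (simp add: form_scale_right[OF b y z])
  from this[of 1] this[of \<i>] show ?thesis by (simp add: complex_eq_iff)
qed

lemma ell2_sum: "(\<And>i. i \<in> I \<Longrightarrow> f i \<in> ell2) \<Longrightarrow> (\<lambda>n. \<Sum>i\<in>I. f i n) \<in> ell2"
  by (induction I rule: infinite_finite_induct) (simp_all add: ell2_zero ell2_add)

lemma inner_sum_left:
  "(\<And>i. i \<in> I \<Longrightarrow> f i \<in> ell2) \<Longrightarrow> y \<in> ell2 \<Longrightarrow>
   ell2_inner (\<lambda>n. \<Sum>i\<in>I. f i n) y = (\<Sum>i\<in>I. ell2_inner (f i) y)"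
  by (induction I rule: infinite_finite_induct) (simp_all add: inner_zero_left inner_add_left ell2_sum)

locale spectral_resolution =
  fixes T :: "(nat \<Rightarrow> complex) \<Rightarrow> (nat \<Rightarrow> complex)" and E
  assumes spectral: "is_spectral_measure T E"
    and closed: "x \<in> ell2 \<Longrightarrow> T x \<in> ell2"
    and form: "hermitian_form (\<lambda>x y. ell2_inner (T x) y)"
begin

lemma
  assumes "S \<in> sets borel"
  shows E_closed: "x \<in> ell2 \<Longrightarrow> E S x \<in> ell2"
    and E_additive: "x \<in> ell2 \<Longrightarrow> y \<in> ell2 \<Longrightarrow> E S (\<lambda>n. x n + y n) = (\<lambda>n. E S x n + E S y n)"
    and E_homogeneous: "x \<in> ell2 \<Longrightarrow> E S (\<lambda>n. c * x n) = (\<lambda>n. c * E S x n)"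
    and E_idempotent: "x \<in> ell2 \<Longrightarrow> E S (E S x) = E S x"
    and E_symmetric: "x \<in> ell2 \<Longrightarrow> y \<in> ell2 \<Longrightarrow> ell2_inner (E S x) y = ell2_inner x (E S y)"
proof -
  have "orthogonal_projection (E S)"
    using spectral assms unfolding is_spectral_measure_def projection_valued_measure_def by blast
  note P = this[unfolded orthogonal_projection_def bounded_operator_def]
  show "x \<in> ell2 \<Longrightarrow> E S x \<in> ell2" using P by blast
  show "x \<in> ell2 \<Longrightarrow> y \<in> ell2 \<Longrightarrow> E S (\<lambda>n. x n + y n) = (\<lambda>n. E S x n + E S y n)"
    by (rule P[THEN conjunct1, THEN conjunct2, THEN conjunct1, rule_format])
  show "x \<in> ell2 \<Longrightarrow> E S (\<lambda>n. c * x n) = (\<lambda>n. c * E S x n)"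
    by (rule P[THEN conjunct1, THEN conjunct2, THEN conjunct2, THEN conjunct1, rule_format])
  show "x \<in> ell2 \<Longrightarrow> E S (E S x) = E S x" using P by blast
  show "x \<in> ell2 \<Longrightarrow> y \<in> ell2 \<Longrightarrow> ell2_inner (E S x) y = ell2_inner x (E S y)" using P by blast
qed

lemma E_difference:
  assumes "S \<in> sets borel" "x \<in> ell2" "y \<in> ell2"
  shows "E S (\<lambda>n. x n - y n) = (\<lambda>n. E S x n - E S y n)"
  using E_additive[OF assms(1,2) ell2_scale[OF assms(3), of "-1"]] E_homogeneous[OF assms(1,3), of "-1"]
  by simp

lemma
  assumes x: "x \<in> ell2"
  shows E_empty: "E {} x = (\<lambda>n. 0)" and E_UNIV: "E UNIV x = x"
    and E_inter: "S \<in> sets borel \<Longrightarrow> R \<in> sets borel \<Longrightarrow> E (S \<inter> R) x = E S (E R x)"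
    and E_sums: "range F \<subseteq> sets borel \<Longrightarrow> disjoint_family F \<Longrightarrow>
      (\<lambda>N. ell2_norm (\<lambda>n. E (\<Union>i. F i) x n - (\<Sum>i<N. E (F i) x n))) \<longlonglongrightarrow> 0"
  using spectral x unfolding is_spectral_measure_def projection_valued_measure_def by blast+

lemma inner_T: "x \<in> ell2 \<Longrightarrow> ell2_inner (T x) x = complex_of_real (LINT t|scalar_measure E x. t)"
  using spectral unfolding is_spectral_measure_def by blast

text \<open>Complements come from countable additivity, applied to the sequence \<open>S, -S, {}, {}, \<dots>\<close>.\<close>

lemma E_Compl:
  assumes S: "S \<in> sets borel" and x: "x \<in> ell2" shows "E (- S) x = (\<lambda>n. x n - E S x n)"
proof -
  have S': "- S \<in> sets borel" using S by auto
  define F where "F i = (if i = 0 then S else if i = 1 then - S else {})" for i :: nat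
  have F: "range F \<subseteq> sets borel" "disjoint_family F"
    unfolding F_def disjoint_family_on_def using S S' by auto
  have U: "(\<Union>i. F i) = UNIV"
  proof -
    have "F 0 \<union> F 1 \<subseteq> (\<Union>i. F i)" by blast
    then show ?thesis by (auto simp: F_def)
  qed
  let ?d = "\<lambda>n. x n - (E S x n + E (- S) x n)"
  have d: "?d \<in> ell2" using S S' x by (intro ell2_diff ell2_add E_closed)
  have "(\<Sum>i<N + 2. E (F i) x n) = E S x n + E (- S) x n" for N n
    by (induction N) (simp_all add: F_def E_empty[OF x] numeral_2_eq_2)
  then have "(\<lambda>N. ell2_norm ?d) \<longlonglongrightarrow> (0::real)"
    using LIMSEQ_ignore_initial_segment[OF E_sums[OF x F], of 2] unfolding U E_UNIV[OF x] by simp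
  then have "ell2_norm ?d = 0" by (simp add: LIMSEQ_const_iff)
  then have "?d = (\<lambda>n. 0)" using d by (simp add: ell2_norm_zero_iff)
  then show ?thesis by (auto simp: fun_eq_iff algebra_simps)
qed

lemma inner_E_self:
  assumes "S \<in> sets borel" "x \<in> ell2" shows "ell2_inner (E S x) x = ell2_inner (E S x) (E S x)"
  using assms E_symmetric[of S "E S x" x] by (simp add: E_closed E_idempotent)

lemma inner_E_nonneg: "S \<in> sets borel \<Longrightarrow> x \<in> ell2 \<Longrightarrow> 0 \<le> Re (ell2_inner (E S x) x)"
  by (simp add: inner_E_self Re_inner_self E_closed)

lemma sets_scalar_measure: "sets (scalar_measure E x) = sets borel"
  unfolding scalar_measure_def using sets.sigma_sets_eq[of "borel :: real measure"] by (simp add: sets_measure_of)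

lemma space_scalar_measure: "space (scalar_measure E x) = UNIV"
  unfolding scalar_measure_def by (simp add: space_measure_of)

lemma emeasure_scalar_measure:
  assumes S: "S \<in> sets borel" and x: "x \<in> ell2"
  shows "emeasure (scalar_measure E x) S = ennreal (Re (ell2_inner (E S x) x))"
proof (rule emeasure_measure_of[OF scalar_measure_def])
  show "positive (sets (scalar_measure E x)) (\<lambda>S. ennreal (Re (ell2_inner (E S x) x)))"
    by (simp add: positive_def E_empty[OF x] inner_zero_left)
  show "countably_additive (sets (scalar_measure E x)) (\<lambda>S. ennreal (Re (ell2_inner (E S x) x)))"
    unfolding countably_additive_def sets_scalar_measure
  proof (intro allI impI)
    fix F :: "nat \<Rightarrow> real set"
    assume F: "range F \<subseteq> sets borel" and d: "disjoint_family F"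
    have Fb: "F i \<in> sets borel" for i using F by auto
    have U: "(\<Union>i. F i) \<in> sets borel" using Fb by auto
    have "(\<lambda>N. Re (ell2_inner (E (\<Union>i. F i) x) x) - (\<Sum>i<N. Re (ell2_inner (E (F i) x) x))) \<longlonglongrightarrow> 0"
    proof (rule Lim_null_comparison)
      have "norm (Re (ell2_inner (E (\<Union>i. F i) x) x) - (\<Sum>i<N. Re (ell2_inner (E (F i) x) x)))
         \<le> ell2_norm (\<lambda>n. E (\<Union>i. F i) x n - (\<Sum>i<N. E (F i) x n)) * ell2_norm x" for N
      proof -
        have "Re (ell2_inner (E (\<Union>i. F i) x) x) - (\<Sum>i<N. Re (ell2_inner (E (F i) x) x)) =
            Re (ell2_inner (\<lambda>n. E (\<Union>i. F i) x n - (\<Sum>i<N. E (F i) x n)) x)"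
          using x U Fb by (simp add: inner_diff_left inner_sum_left ell2_sum E_closed)
        then show ?thesis
          using abs_Re_le_cmod inner_Cauchy_Schwarz[OF ell2_diff[OF E_closed[OF U x] ell2_sum] x, of "{..<N}" "\<lambda>i. E (F i) x"]
            E_closed[OF Fb x] order_trans by fastforce
      qed
      then show "\<forall>\<^sub>F N in sequentially. norm (Re (ell2_inner (E (\<Union>i. F i) x) x) - (\<Sum>i<N. Re (ell2_inner (E (F i) x) x)))
         \<le> ell2_norm (\<lambda>n. E (\<Union>i. F i) x n - (\<Sum>i<N. E (F i) x n)) * ell2_norm x" by simp
      show "(\<lambda>N. ell2_norm (\<lambda>n. E (\<Union>i. F i) x n - (\<Sum>i<N. E (F i) x n)) * ell2_norm x) \<longlonglongrightarrow> 0"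
        using tendsto_mult_right[OF E_sums[OF x F d], of "ell2_norm x"] by simp
    qed
    from tendsto_diff[OF tendsto_const[of "Re (ell2_inner (E (\<Union>i. F i) x) x)"] this]
    have "(\<lambda>i. Re (ell2_inner (E (F i) x) x)) sums Re (ell2_inner (E (\<Union>i. F i) x) x)"
      by (simp add: sums_def)
    then show "(\<Sum>i. ennreal (Re (ell2_inner (E (F i) x) x))) = ennreal (Re (ell2_inner (E (\<Union>i. F i) x) x))"
      by (intro suminf_ennreal_eq inner_E_nonneg Fb x)
  qed
qed (use S sets_scalar_measure in auto)

lemma finite_scalar_measure: "x \<in> ell2 \<Longrightarrow> finite_measure (scalar_measure E x)"
  by (rule finite_measureI) (simp add: space_scalar_measure emeasure_scalar_measure)

lemma integral_one: "x \<in> ell2 \<Longrightarrow> (LINT t|scalar_measure E x. 1) = Re (ell2_inner x x)"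
  by (simp add: space_scalar_measure measure_def emeasure_scalar_measure E_UNIV Re_inner_self)

lemma AE_scalar_measure:
  assumes S: "S \<in> sets borel" and x: "x \<in> ell2" and "E S x = x"
  shows "AE t in scalar_measure E x. t \<in> S"
proof (rule AE_I')
  have "- S \<in> sets borel" using S by auto
  moreover have "E (- S) x = (\<lambda>n. 0)" using assms by (simp add: E_Compl)
  ultimately show "- S \<in> null_sets (scalar_measure E x)"
    using x by (simp add: null_sets_def sets_scalar_measure emeasure_scalar_measure inner_zero_left)
qed auto

lemma integrable_scalar_measure:
  assumes x: "x \<in> ell2" shows "integrable (scalar_measure E x) (\<lambda>t. t)"
proof -
  interpret finite_measure "scalar_measure E x" by (rule finite_scalar_measure[OF x])
  obtain a where "E {-a..a} x = x" using spectral x unfolding is_spectral_measure_def by blast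
  then have "AE t in scalar_measure E x. t \<in> {-a..a}" using x by (intro AE_scalar_measure) auto
  then have "AE t in scalar_measure E x. norm t \<le> a" by (rule eventually_mono) auto
  then show ?thesis
    by (rule integrable_const_bound) (simp add: measurable_cong_sets[OF sets_scalar_measure refl])
qed

text \<open>Let \<open>y\<close> be in the range of \<open>E(S)\<close> and \<open>z\<close> in its kernel. Since \<open>\<langle>E(R) y, z\<rangle> = 0\<close> for all \<open>R\<close>, the vectors \<open>y + c z\<close> and
\<open>y - c z\<close> have the same scalar measure, hence the same quadratic form of \<open>T\<close>.\<close>

lemma T_orthogonal:
  assumes S: "S \<in> sets borel" and y: "y \<in> ell2" and z: "z \<in> ell2"
    and Ey: "E S y = y" and Ez: "E S z = (\<lambda>n. 0)"
  shows "ell2_inner (T y) z = 0"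
proof (rule form_eq_zeroI[OF form y z])
  fix c
  let ?p = "\<lambda>n. y n + c * z n" and ?m = "\<lambda>n. y n - c * z n"
  have cz: "(\<lambda>n. c * z n) \<in> ell2" by (rule ell2_scale[OF z])
  have p: "?p \<in> ell2" and m: "?m \<in> ell2" using y cz by (auto intro: ell2_add ell2_diff)
  have "Re (ell2_inner (E R ?p) ?p) = Re (ell2_inner (E R ?m) ?m)" if R: "R \<in> sets borel" for R
  proof -
    have "hermitian_form (\<lambda>x y. ell2_inner (E R x) y)"
      unfolding hermitian_form_def
    proof (intro conjI allI ballI)
      fix x y assume "x \<in> ell2" "y \<in> ell2"
      then show "ell2_inner (E R y) x = cnj (ell2_inner (E R x) y)"
        using R inner_cnj[of "E R x" y] E_symmetric[OF R, of y x] by (simp add: E_closed)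
    qed (simp_all add: R E_additive E_homogeneous inner_add_left inner_scale_left E_closed)
    from form_sum_minus_difference[OF this y cz]
    have "Re (ell2_inner (E R ?p) ?p) - Re (ell2_inner (E R ?m) ?m) = 4 * Re (ell2_inner (E R y) (\<lambda>n. c * z n))" .
    also have "E R y = E S (E R y)"
      using E_inter[OF y R S] E_inter[OF y S R] Ey by (simp add: Int_commute)
    also have "ell2_inner (E S (E R y)) (\<lambda>n. c * z n) = 0"
      using S R y cz z by (simp add: E_symmetric E_closed E_homogeneous Ez inner_zero_right)
    finally show ?thesis by simp
  qed
  then have "scalar_measure E ?p = scalar_measure E ?m"
    by (intro scalar_measure_eqI) (simp_all add: sets_scalar_measure emeasure_scalar_measure m)
  then show "ell2_inner (T ?p) ?p = ell2_inner (T ?m) ?m" by (simp add: inner_T p m)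
qed

text \<open>The scalar measure of a vector \<open>p\<close> in the range of \<open>E({\<mu>})\<close> is a point mass at \<open>\<mu>\<close>, so \<open>\<langle>T p, p\<rangle> = \<mu> \<langle>p, p\<rangle>\<close>. By polarization
\<open>(T - \<mu>) p\<close> is orthogonal to this range, and \<open>T_orthogonal\<close> adds the kernel of \<open>E({\<mu>})\<close>.\<close>

lemma E_point_is_eigenvector:
  assumes x: "x \<in> ell2" shows "T (E {\<mu>} x) = (\<lambda>n. complex_of_real \<mu> * E {\<mu>} x n)"
proof -
  have S: "{\<mu>} \<in> sets borel" by simp
  let ?b = "\<lambda>x y. ell2_inner (T x) y - complex_of_real \<mu> * ell2_inner x y"
  have b: "hermitian_form ?b"
    unfolding hermitian_form_def
  proof (intro conjI allI ballI)
    fix x y assume "x \<in> ell2" "y \<in> ell2"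
    then show "?b y x = cnj (?b x y)"
      using form_cnj[OF form, of x y] inner_cnj[of x y] by simp
  qed (simp_all add: form_add_left[OF form] form_scale_left[OF form] inner_add_left inner_scale_left algebra_simps)
  have diag: "?b p p = 0" if p: "p \<in> ell2" and Ep: "E {\<mu>} p = p" for p
  proof -
    have "(LINT t|scalar_measure E p. t) = (LINT t|scalar_measure E p. \<mu> * 1)"
      by (rule integral_cong_AE)
        (use AE_scalar_measure[OF S p Ep] in \<open>auto simp: measurable_cong_sets[OF sets_scalar_measure refl]\<close>)
    also have "\<dots> = \<mu> * Re (ell2_inner p p)"
      by (subst integral_mult_right_zero) (simp only: integral_one[OF p])
    finally show ?thesis
      using form_diagonal_real[OF hermitian_form_inner p] by (simp add: inner_T[OF p])
  qed
  let ?y = "E {\<mu>} x"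
  have y: "?y \<in> ell2" by (rule E_closed[OF S x])
  have "ell2_inner (T ?y) w = complex_of_real \<mu> * ell2_inner ?y w" if w: "w \<in> ell2" for w
  proof -
    let ?q = "E {\<mu>} w" and ?r = "\<lambda>n. w n - E {\<mu>} w n"
    have q: "?q \<in> ell2" by (rule E_closed[OF S w])
    have r: "?r \<in> ell2" by (rule ell2_diff[OF w q])
    have "ell2_inner (T ?y) ?r = 0"
      by (rule T_orthogonal[OF S y r])
        (simp_all add: E_idempotent[OF S] x w E_difference[OF S w q])
    moreover have "ell2_inner ?y ?r = 0"
      using E_symmetric[OF S x r] by (simp add: E_difference[OF S w q] E_idempotent[OF S w] inner_zero_right)
    moreover have "?b ?y ?q = 0"
    proof (rule form_eq_zeroI[OF b y q])
      fix c
      have "?b (\<lambda>n. ?y n + c * ?q n) (\<lambda>n. ?y n + c * ?q n) = 0"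
        by (rule diag) (simp_all add: ell2_add ell2_scale y q E_additive[OF S] E_homogeneous[OF S] E_idempotent[OF S] x w)
      moreover have "?b (\<lambda>n. ?y n - c * ?q n) (\<lambda>n. ?y n - c * ?q n) = 0"
        by (rule diag) (simp_all add: ell2_diff ell2_scale y q E_difference[OF S] E_homogeneous[OF S] E_idempotent[OF S] x w)
      ultimately show "?b (\<lambda>n. ?y n + c * ?q n) (\<lambda>n. ?y n + c * ?q n) = ?b (\<lambda>n. ?y n - c * ?q n) (\<lambda>n. ?y n - c * ?q n)"
        by simp
    qed
    ultimately show ?thesis
      using inner_diff_right[OF closed[OF y] w q] inner_diff_right[OF y w q] by simp
  qed
  from this[OF unit_vec_ell2] show ?thesis by (simp add: inner_unit_vec fun_eq_iff)
qed

text \<open>The part \<open>y\<close> of an eigenvector in the range of \<open>E(S)\<close> has \<open>\<langle>T y, y\<rangle> = \<mu> \<langle>y, y\<rangle>\<close>, that is, the integral of \<open>t - \<mu>\<close>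
against its scalar measure vanishes. If \<open>S\<close> lies strictly on one side of \<open>\<mu>\<close>, this forces the measure to be 0. The sign \<open>\<sigma>\<close> treats both sides
at once.\<close>

lemma E_halfline_eq_zero:
  assumes x: "x \<in> ell2" and eig: "T x = (\<lambda>n. complex_of_real \<mu> * x n)"
    and S: "S \<in> sets borel" and \<sigma>: "\<And>t. t \<in> S \<Longrightarrow> 0 < \<sigma> * (t - \<mu>)"
  shows "E S x = (\<lambda>n. 0)"
proof -
  let ?y = "E S x" and ?z = "\<lambda>n. x n - E S x n"
  have y: "?y \<in> ell2" and z: "?z \<in> ell2" using x S by (auto intro: ell2_diff E_closed)
  interpret finite_measure "scalar_measure E ?y" by (rule finite_scalar_measure[OF y])
  have "ell2_inner (T x) ?y = ell2_inner (T ?y) ?y + ell2_inner (T ?z) ?y"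
    using form_add_left[OF form y z y] by simp
  also have "ell2_inner (T ?z) ?y = 0"
    using form_cnj[OF form y z] T_orthogonal[OF S y z] x S
    by (simp add: E_idempotent E_difference E_closed)
  also have "ell2_inner (T x) ?y = complex_of_real \<mu> * ell2_inner ?y ?y"
    using x y S E_symmetric[OF S x x] inner_E_self[OF S x] by (simp add: eig inner_scale_left)
  finally have "complex_of_real (LINT t|scalar_measure E ?y. t) = complex_of_real (\<mu> * Re (ell2_inner ?y ?y))"
    using inner_T[OF y] form_diagonal_real[OF hermitian_form_inner y] by simp
  then have mean: "(LINT t|scalar_measure E ?y. t) = \<mu> * (LINT t|scalar_measure E ?y. 1)"
    unfolding integral_one[OF y] of_real_eq_iff .
  have ae: "AE t in scalar_measure E ?y. 0 < \<sigma> * (t - \<mu>)"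
    using AE_scalar_measure[OF S y E_idempotent[OF S x]] \<sigma> by (auto elim: eventually_mono)
  have int: "integrable (scalar_measure E ?y) (\<lambda>t. \<sigma> * (t - \<mu>))"
    using Bochner_Integration.integrable_diff[OF integrable_scalar_measure[OF y] integrable_const[of \<mu>]]
    by (intro integrable_mult_right)
  have "(LINT t|scalar_measure E ?y. \<sigma> * (t - \<mu>)) = \<sigma> * ((LINT t|scalar_measure E ?y. t) - (LINT t|scalar_measure E ?y. \<mu> * 1))"
    using integrable_scalar_measure[OF y] by simp
  also have "\<dots> = 0" unfolding integral_mult_right_zero mean by simp
  finally have "(LINT t|scalar_measure E ?y. \<sigma> * (t - \<mu>)) = 0" .
  then have "AE t in scalar_measure E ?y. \<sigma> * (t - \<mu>) = 0"
    using integral_nonneg_eq_0_iff_AE[OF int eventually_mono[OF ae less_imp_le]] by (simp only:)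
  with ae have "AE t in scalar_measure E ?y. False" by eventually_elim simp
  then have "emeasure (scalar_measure E ?y) UNIV = 0"
    using ae_filter_eq_bot_iff[of "scalar_measure E ?y"] by (simp add: trivial_limit_def space_scalar_measure)
  then have "Re (ell2_inner ?y ?y) \<le> 0"
    using emeasure_scalar_measure[of UNIV, OF _ y] by (simp add: E_UNIV[OF y] ennreal_eq_0_iff)
  then show ?thesis using y by (simp add: Re_inner_self ell2_norm_zero_iff)
qed

theorem E_point_fixes_eigenvector:
  assumes x: "x \<in> ell2" and eig: "T x = (\<lambda>n. complex_of_real \<mu> * x n)"
  shows "E {\<mu>} x = x"
proof -
  have "E {\<mu><..} x = (\<lambda>n. 0)" by (rule E_halfline_eq_zero[OF x eig, where \<sigma> = 1]) auto
  then have "E {..\<mu>} x = x" using E_Compl[of "{\<mu><..}", OF _ x] by (simp add: Compl_greaterThan)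
  moreover have "E {..<\<mu>} x = (\<lambda>n. 0)" by (rule E_halfline_eq_zero[OF x eig, where \<sigma> = "-1"]) auto
  then have "E {\<mu>..} x = x" using E_Compl[of "{..<\<mu>}", OF _ x] by (simp add: Compl_lessThan)
  moreover have "{\<mu>} = {..\<mu>} \<inter> {\<mu>..}" by auto
  ultimately show ?thesis using E_inter[OF x, of "{..\<mu>}" "{\<mu>..}"] by simp
qed

end

section \<open>Eigenvectors of discrete Schroedinger operators\<close>

definition shift_left :: "(nat \<Rightarrow> complex) \<Rightarrow> nat \<Rightarrow> complex" where "shift_left x n = x (Suc n)"

definition shift_right :: "(nat \<Rightarrow> complex) \<Rightarrow> nat \<Rightarrow> complex" where
  "shift_right x n = (if n = 0 then 0 else x (n - 1))"

lemma shift_left_ell2: "x \<in> ell2 \<Longrightarrow> shift_left x \<in> ell2"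
  unfolding ell2_def shift_left_def using summable_Suc_iff[of "\<lambda>n. (norm (x n))\<^sup>2"] by simp

lemma shift_right_ell2: "x \<in> ell2 \<Longrightarrow> shift_right x \<in> ell2"
  unfolding ell2_def using summable_Suc_iff[of "\<lambda>n. (norm (shift_right x n))\<^sup>2"] by (simp add: shift_right_def)

lemma inner_shift:
  assumes "x \<in> ell2" "y \<in> ell2" shows "ell2_inner (shift_left x) y = ell2_inner x (shift_right y)"
  using suminf_split_head[OF summable_ell2_inner[OF assms(1) shift_right_ell2[OF assms(2)]]]
  unfolding ell2_inner_def by (simp add: shift_left_def shift_right_def)

lemma ell2_norm_shift_left_le:
  assumes x: "x \<in> ell2" shows "ell2_norm (shift_left x) \<le> ell2_norm x"
proof -
  have "summable (\<lambda>n. (norm (x n))\<^sup>2)" using x by (simp add: ell2_def)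
  from suminf_split_head[OF this] show ?thesis
    unfolding ell2_norm_def shift_left_def by simp
qed

lemma Hv_eq: "Hv v x = (\<lambda>n. ((2 + complex_of_real (v n)) * x n - shift_left x n) - shift_right x n)"
  unfolding Hv_def H0_def shift_left_def shift_right_def by (auto simp: algebra_simps)

context
  fixes v :: "nat \<Rightarrow> real" and V :: real
  assumes V: "\<And>n. \<bar>v n\<bar> \<le> V"
begin

lemma diagonal_ell2:
  assumes "x \<in> ell2" shows "(\<lambda>n. (2 + complex_of_real (v n)) * x n) \<in> ell2"
proof (rule ell2_comparison[OF assms])
  show "norm ((2 + complex_of_real (v n)) * x n) \<le> (2 + V) * norm (x n)" for n
    unfolding norm_mult using norm_triangle_ineq[of 2 "complex_of_real (v n)"] V[of n]
    by (intro mult_right_mono) auto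
qed

lemma Hv_closed: "x \<in> ell2 \<Longrightarrow> Hv v x \<in> ell2"
  unfolding Hv_eq by (intro ell2_diff diagonal_ell2 shift_left_ell2 shift_right_ell2)

lemma Hv_additive: "Hv v (\<lambda>n. x n + y n) = (\<lambda>n. Hv v x n + Hv v y n)"
  unfolding Hv_def H0_def by (auto simp: algebra_simps)

lemma Hv_homogeneous: "Hv v (\<lambda>n. c * x n) = (\<lambda>n. c * Hv v x n)"
  unfolding Hv_def H0_def by (auto simp: algebra_simps)

lemma inner_Hv:
  assumes x: "x \<in> ell2" and y: "y \<in> ell2"
  shows "ell2_inner (Hv v x) y =
    ell2_inner (\<lambda>n. (2 + complex_of_real (v n)) * x n) y - ell2_inner (shift_left x) y - ell2_inner (shift_right x) y"
  unfolding Hv_eq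
  by (subst inner_diff_left, (intro ell2_diff diagonal_ell2 shift_left_ell2 shift_right_ell2 x y)+,
      subst inner_diff_left, (intro ell2_diff diagonal_ell2 shift_left_ell2 shift_right_ell2 x y)+) (rule refl)

lemma Hv_form: "hermitian_form (\<lambda>x y. ell2_inner (Hv v x) y)"
  unfolding hermitian_form_def
proof (intro conjI allI ballI)
  fix x y assume x: "x \<in> ell2" and y: "y \<in> ell2"
  have "ell2_inner (\<lambda>n. (2 + complex_of_real (v n)) * y n) x = cnj (ell2_inner (\<lambda>n. (2 + complex_of_real (v n)) * x n) y)"
  proof -
    have "ell2_inner (\<lambda>n. (2 + complex_of_real (v n)) * y n) x = ell2_inner y (\<lambda>n. (2 + complex_of_real (v n)) * x n)"
      unfolding ell2_inner_def by (simp add: mult_ac)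
    then show ?thesis using inner_cnj[OF diagonal_ell2[OF x] y] by simp
  qed
  moreover have "ell2_inner (shift_left y) x = cnj (ell2_inner (shift_right x) y)"
    unfolding inner_shift[OF y x] by (rule inner_cnj[OF shift_right_ell2[OF x] y])
  moreover have "ell2_inner (shift_right y) x = cnj (ell2_inner (shift_left x) y)"
    unfolding inner_shift[OF x y] by (rule inner_cnj[OF x shift_right_ell2[OF y]])
  ultimately show "ell2_inner (Hv v y) x = cnj (ell2_inner (Hv v x) y)"
    by (simp add: inner_Hv x y)
qed (simp_all add: Hv_additive Hv_homogeneous inner_add_left inner_scale_left Hv_closed)

text \<open>The shifts have norm at most 1 and contribute 2, the diagonal contributes \<open>2 + V\<close>.\<close>

lemma Hv_numerical_range:
  assumes x: "x \<in> ell2" shows "\<bar>Re (ell2_inner (Hv v x) x)\<bar> \<le> (4 + V) * Re (ell2_inner x x)"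
proof -
  let ?D = "\<lambda>n. (2 + complex_of_real (v n)) * x n"
  have "Re (ell2_inner (shift_right x) x) = Re (ell2_inner (shift_left x) x)"
    using inner_shift[OF x x] inner_cnj[OF x shift_right_ell2[OF x]] by simp
  then have "Re (ell2_inner (Hv v x) x) = Re (ell2_inner ?D x) - 2 * Re (ell2_inner (shift_left x) x)"
    using inner_Hv[OF x x] by simp
  moreover have "\<bar>Re (ell2_inner (shift_left x) x)\<bar> \<le> Re (ell2_inner x x)"
  proof -
    have "norm (ell2_inner (shift_left x) x) \<le> ell2_norm (shift_left x) * ell2_norm x"
      by (rule inner_Cauchy_Schwarz[OF shift_left_ell2[OF x] x])
    also have "\<dots> \<le> ell2_norm x * ell2_norm x"
      by (intro mult_right_mono ell2_norm_shift_left_le ell2_norm_nonneg x)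
    finally show ?thesis
      using abs_Re_le_cmod[of "ell2_inner (shift_left x) x"] x by (simp add: Re_inner_self power2_eq_square)
  qed
  moreover have "\<bar>Re (ell2_inner ?D x)\<bar> \<le> (2 + V) * Re (ell2_inner x x)"
  proof -
    have s: "summable (\<lambda>n. (norm (x n))\<^sup>2)" using x by (simp add: ell2_def)
    have "norm (?D n * cnj (x n)) \<le> (2 + V) * (norm (x n))\<^sup>2" for n
    proof -
      have "norm (?D n * cnj (x n)) = norm (2 + complex_of_real (v n)) * (norm (x n))\<^sup>2"
        by (simp add: norm_mult power2_eq_square)
      also have "\<dots> \<le> (2 + V) * (norm (x n))\<^sup>2"
        using norm_triangle_ineq[of 2 "complex_of_real (v n)"] V[of n] by (intro mult_right_mono) auto
      finally show ?thesis .
    qed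
    then have "norm (ell2_inner ?D x) \<le> (\<Sum>n. (2 + V) * (norm (x n))\<^sup>2)"
      unfolding ell2_inner_def by (intro norm_suminf_le summable_mult s)
    also have "\<dots> = (2 + V) * Re (ell2_inner x x)"
      using x by (simp add: suminf_mult[OF s] inner_self)
    finally show ?thesis using abs_Re_le_cmod order_trans by blast
  qed
  ultimately show ?thesis by (simp add: distrib_right abs_le_iff)
qed

text \<open>The operator \<open>(H\<^sub>v + a) / (2 a)\<close> with \<open>a = 4 + V\<close> lies between 0 and 1.\<close>

lemma Hv_has_spectral_measure: "\<exists>E. is_spectral_measure (Hv v) E"
proof -
  define a where "a = 4 + V"
  have a: "a > 0" using V[of 0] by (simp add: a_def)
  define A where "A x = (\<lambda>n. complex_of_real (1 / (2 * a)) * (Hv v x n + complex_of_real a * x n))"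
    for x :: "nat \<Rightarrow> complex"
  have inner_A: "ell2_inner (A x) y = complex_of_real (1 / (2 * a)) * (ell2_inner (Hv v x) y + complex_of_real a * ell2_inner x y)"
    if "x \<in> ell2" "y \<in> ell2" for x y
    unfolding A_def using that by (simp only: inner_scale_left inner_add_left Hv_closed ell2_scale ell2_add)
  have Re_A: "Re (ell2_inner (A x) x) = (Re (ell2_inner (Hv v x) x) + a * Re (ell2_inner x x)) / (2 * a)" if "x \<in> ell2" for x
    using inner_A[OF that that] by simp
  interpret A: ell2_effect A
  proof
    fix x y :: "nat \<Rightarrow> complex" and c assume x: "x \<in> ell2"
    show "A x \<in> ell2" unfolding A_def by (intro ell2_scale ell2_add Hv_closed x)
    show "A (\<lambda>n. c * x n) = (\<lambda>n. c * A x n)"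
      unfolding A_def Hv_homogeneous by (simp only: distrib_left mult.left_commute)
    show "0 \<le> Re (ell2_inner (A x) x)"
      using Hv_numerical_range[OF x] a unfolding Re_A[OF x] a_def by (intro divide_nonneg_pos) (simp_all add: abs_le_iff)
    have "Re (ell2_inner (Hv v x) x) \<le> a * Re (ell2_inner x x)"
      using Hv_numerical_range[OF x] unfolding a_def by linarith
    then show "Re (ell2_inner (A x) x) \<le> Re (ell2_inner x x)"
      using a unfolding Re_A[OF x] by (simp add: pos_divide_le_eq algebra_simps)
    assume y: "y \<in> ell2"
    show "A (\<lambda>n. x n + y n) = (\<lambda>n. A x n + A y n)"
      unfolding A_def Hv_additive by (simp only: distrib_left add_ac)
    have "ell2_inner (A y) x = cnj (ell2_inner (A x) y)"
      using form_cnj[OF Hv_form x y] inner_cnj[OF x y] x y by (simp add: inner_A)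
    moreover have "A y \<in> ell2" unfolding A_def by (intro ell2_scale ell2_add Hv_closed y)
    ultimately show "ell2_inner (A x) y = ell2_inner x (A y)"
      using inner_cnj[of "A y" x] x by simp
  qed
  have "Hv v x = (\<lambda>n. complex_of_real (2 * a) * A x n + complex_of_real (- a) * x n)" for x
    using a unfolding A_def by (simp add: fun_eq_iff)
  then show ?thesis using A.spectral_measure_affine by blast
qed

end

lemma spectral_resolution_Hv:
  assumes "v \<in> bounded_potentials"
  shows "spectral_resolution (Hv v) (spectral_measure (Hv v))"
proof -
  obtain V where V: "\<And>n. \<bar>v n\<bar> \<le> V"
    using assms unfolding bounded_potentials_def bounded_iff by auto
  show ?thesis
  proof
    show "is_spectral_measure (Hv v) (spectral_measure (Hv v))"
      unfolding spectral_measure_def by (rule someI_ex[OF Hv_has_spectral_measure[OF V]])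
  qed (use Hv_closed[OF V] Hv_form[OF V] in auto)
qed

text \<open>The formal solution of \<open>H\<^sub>v u = u\<close> with \<open>u(0) = 1\<close>, square summable or not.\<close>

fun eigensequence :: "(nat \<Rightarrow> real) \<Rightarrow> nat \<Rightarrow> real" where
  "eigensequence v 0 = 1"
| "eigensequence v (Suc 0) = 1 + v 0"
| "eigensequence v (Suc (Suc n)) = (1 + v (Suc n)) * eigensequence v (Suc n) - eigensequence v n"

lemma eigensequence_solves: "Hv v (\<lambda>n. complex_of_real (eigensequence v n)) = (\<lambda>n. complex_of_real (eigensequence v n))"
proof
  fix n
  show "Hv v (\<lambda>n. complex_of_real (eigensequence v n)) n = complex_of_real (eigensequence v n)"
    by (cases n) (simp_all add: Hv_def H0_def algebra_simps)
qed

lemma eigensequence_unique: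
  assumes "Hv v x = x" shows "x n = x 0 * complex_of_real (eigensequence v n)"
proof (induction n rule: induct_nat_012)
  case 0 then show ?case by simp
next
  case 1
  have "Hv v x 0 = x 0" using assms by simp
  then show ?case by (simp add: Hv_def H0_def algebra_simps)
next
  case (ge2 n)
  have "Hv v x (Suc n) = x (Suc n)" using assms by simp
  then have "x (Suc (Suc n)) = (1 + complex_of_real (v (Suc n))) * x (Suc n) - x n"
    by (simp add: Hv_def H0_def algebra_simps)
  then show ?case by (simp only: ge2) (simp add: algebra_simps)
qed

text \<open>Here \<open>E({1})\<close> fixes \<open>u\<close> and has all its values in the span of \<open>u\<close>. So \<open>E({1}) e\<^sub>j = c u\<close>, and pairing with \<open>u\<close> gives
\<open>c \<parallel>u\<parallel>\<^sup>2 = u(j)\<close>.\<close>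

lemma Xi_hat_square_summable:
  assumes v: "v \<in> bounded_potentials" and s: "summable (\<lambda>n. (eigensequence v n)\<^sup>2)"
  shows "Xi_hat (v, j) = (eigensequence v j)\<^sup>2 / (\<Sum>n. (eigensequence v n)\<^sup>2)"
proof -
  interpret spectral_resolution "Hv v" "spectral_measure (Hv v)" by (rule spectral_resolution_Hv[OF v])
  let ?E = "spectral_measure (Hv v) {1}"
  define u where "u n = complex_of_real (eigensequence v n)" for n
  have u: "u \<in> ell2" using s by (simp add: ell2_def u_def)
  have Hu: "Hv v u = u" using eigensequence_solves unfolding u_def[abs_def] .
  have Eu: "?E u = u" using E_point_fixes_eigenvector[OF u, of 1] Hu by simp
  let ?y = "?E (unit_vec j)"
  have y: "?y \<in> ell2" by (rule E_closed[OF _ unit_vec_ell2]) simp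
  have Hy: "Hv v ?y = ?y" using E_point_is_eigenvector[OF unit_vec_ell2, of 1 j] by simp
  have y_eq: "?y = (\<lambda>n. ?y 0 * u n)"
    unfolding u_def by (rule ext) (rule eigensequence_unique[OF Hy])
  have "ell2_inner ?y u = ell2_inner (unit_vec j) u"
    using E_symmetric[of "{1}", OF _ unit_vec_ell2 u, of j] Eu by simp
  also have "\<dots> = u j"
    using inner_cnj[OF u unit_vec_ell2[of j]] by (simp add: inner_unit_vec u_def)
  finally have "ell2_inner ?y u = u j" .
  moreover have "ell2_inner ?y u = ?y 0 * ell2_inner u u"
    using arg_cong[OF y_eq, of "\<lambda>z. ell2_inner z u"] inner_scale_left[OF u u, of "?y 0"] by (rule trans)
  ultimately have "?y 0 * ell2_inner u u = u j" by (simp only:)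
  moreover have "ell2_inner u u = complex_of_real (\<Sum>n. (eigensequence v n)\<^sup>2)"
    using inner_self[OF u] by (simp add: u_def)
  moreover have "(\<Sum>n. (eigensequence v n)\<^sup>2) > 0"
    by (rule suminf_pos2[OF s, of 0]) simp_all
  ultimately have "?y 0 = u j / complex_of_real (\<Sum>n. (eigensequence v n)\<^sup>2)"
    by (simp add: field_simps)
  then have "?y j = u j / complex_of_real (\<Sum>n. (eigensequence v n)\<^sup>2) * u j"
    using fun_cong[OF y_eq, of j] by simp
  then show ?thesis
    unfolding Xi_hat_def by (simp add: inner_unit_vec u_def power2_eq_square flip: of_real_mult of_real_divide)
qed

text \<open>The vector \<open>E({1}) e\<^sub>j\<close> is square summable and a multiple of \<open>u\<close>, so it vanishes.\<close>

lemma Xi_hat_not_square_summable: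
  assumes v: "v \<in> bounded_potentials" and s: "\<not> summable (\<lambda>n. (eigensequence v n)\<^sup>2)"
  shows "Xi_hat (v, j) = 0"
proof -
  interpret spectral_resolution "Hv v" "spectral_measure (Hv v)" by (rule spectral_resolution_Hv[OF v])
  let ?y = "spectral_measure (Hv v) {1} (unit_vec j)"
  have y: "?y \<in> ell2" by (rule E_closed[OF _ unit_vec_ell2]) simp
  have "Hv v ?y = ?y" using E_point_is_eigenvector[OF unit_vec_ell2, of 1 j] by simp
  note y_eq = eigensequence_unique[OF this]
  have "?y 0 = 0"
  proof (rule ccontr)
    assume "?y 0 \<noteq> 0"
    then have "complex_of_real (eigensequence v n) = inverse (?y 0) * ?y n" for n
      using y_eq[of n] by (simp add: field_simps)
    then have "(\<lambda>n. complex_of_real (eigensequence v n)) \<in> ell2"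
      using ell2_scale[OF y, of "inverse (?y 0)"] by simp
    with s show False by (simp add: ell2_def)
  qed
  with y_eq[of j] have "?y j = 0" by simp
  then show ?thesis unfolding Xi_hat_def by (simp add: inner_unit_vec)
qed

section \<open>Computation in one limit\<close>

lemma eigensequence_cong:
  "(\<And>i. i < n \<Longrightarrow> v i = v' i) \<Longrightarrow> eigensequence v n = eigensequence v' n"
  by (induction n rule: induct_nat_012) simp_all

lemma eigensequence_Suc:
  "eigensequence v (Suc n) = (1 + v n) * eigensequence v n - (if n = 0 then 0 else eigensequence v (n - 1))"
  by (cases n) simp_all

definition partial_weight :: "nat \<Rightarrow> (nat \<Rightarrow> real) \<Rightarrow> real" where
  "partial_weight n v = (\<Sum>i<n. (eigensequence v i)\<^sup>2)"

text \<open>The numerator \<open>u(j)\<^sup>2\<close> as a running sum, which is 0 as long as position \<open>j\<close> has not been reached.\<close>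

definition weight_at :: "nat \<Rightarrow> nat \<Rightarrow> (nat \<Rightarrow> real) \<Rightarrow> real" where
  "weight_at n j v = (\<Sum>i<n. if i = j then (eigensequence v i)\<^sup>2 else 0)"

definition xi_approx :: "nat \<Rightarrow> (nat \<Rightarrow> real) \<times> nat \<Rightarrow> real" where
  "xi_approx n = (\<lambda>(v, j). weight_at (Suc n) j v / partial_weight (Suc n) v)"

lemma partial_weight_ge_1: "1 \<le> partial_weight (Suc n) v"
  unfolding partial_weight_def by (subst sum.lessThan_Suc_shift) (simp add: sum_nonneg)

lemma xi_approx_nonneg: "0 \<le> xi_approx n A"
  unfolding xi_approx_def weight_at_def
  using partial_weight_ge_1[of n "fst A"] by (auto simp: case_prod_beta intro!: divide_nonneg_nonneg sum_nonneg)

lemma xi_approx_tendsto: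
  assumes v: "v \<in> bounded_potentials"
  shows "(\<lambda>n. xi_approx n (v, j)) \<longlonglongrightarrow> Xi_hat (v, j)"
proof -
  let ?f = "\<lambda>n. (eigensequence v n)\<^sup>2"
  have ev: "\<forall>\<^sub>F n in sequentially. ?f j / partial_weight (Suc n) v = xi_approx n (v, j)"
    using eventually_ge_at_top[of j]
    by eventually_elim (simp add: xi_approx_def weight_at_def sum.delta less_Suc_eq_le)
  have "(\<lambda>n. ?f j / partial_weight (Suc n) v) \<longlonglongrightarrow> Xi_hat (v, j)"
  proof (cases "summable ?f")
    case True
    have "suminf ?f > 0" by (rule suminf_pos2[OF True, of 0]) simp_all
    moreover have "(\<lambda>n. partial_weight (Suc n) v) \<longlonglongrightarrow> suminf ?f"
      unfolding partial_weight_def using summable_LIMSEQ[OF True] by (rule LIMSEQ_Suc)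
    ultimately show ?thesis
      unfolding Xi_hat_square_summable[OF v True] by (intro tendsto_intros) auto
  next
    case False
    have "filterlim (\<lambda>n. partial_weight (Suc n) v) at_top sequentially"
      unfolding filterlim_at_top
    proof
      fix Z
      obtain N where N: "partial_weight N v > Z"
      proof (rule ccontr)
        assume "\<not> thesis"
        then have "partial_weight N v \<le> Z" for N using that not_le by blast
        then have "summable ?f" by (intro summableI_nonneg_bounded[where x = Z]) (simp_all add: partial_weight_def)
        with False show False ..
      qed
      show "\<forall>\<^sub>F n in sequentially. Z \<le> partial_weight (Suc n) v"
        using eventually_ge_at_top[of N]
      proof eventually_elim
        case (elim n)
        then have "partial_weight N v \<le> partial_weight (Suc n) v"
          unfolding partial_weight_def by (intro sum_mono2) auto
        with N show ?case by simp
      qed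
    qed
    then show ?thesis
      unfolding Xi_hat_not_square_summable[OF v False] by (rule real_tendsto_divide_at_top[OF tendsto_const])
  qed
  then show ?thesis by (rule Lim_transform_eventually) (rule ev)
qed

lemma Xi_hat_nonneg: "v \<in> bounded_potentials \<Longrightarrow> 0 \<le> Xi_hat (v, j)"
  by (rule LIMSEQ_le_const[OF xi_approx_tendsto]) (auto simp: xi_approx_nonneg)

text \<open>Registers: 0 holds the input \<open>n\<close> and at the end the output length, 1 the output, 2 the index \<open>j\<close>, 3 the loop counter
\<open>k\<close>, 4 and 5 the entries \<open>u(k)\<close> and \<open>u(k-1)\<close>, 6 and 7 the running sums of denominator and numerator, 8 is scratch
space. The loop consists of the instructions 2 to 11. The test \<open>k = j\<close> is done arithmetically: by the convention on division by
zero, \<open>1 - (k - j) / (k - j)\<close> is 1 if \<open>k = j\<close> and 0 otherwise.\<close>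

definition xi_program :: "bss_instr list" where
  "xi_program =
    [Query 2,
     Assign 4 (Const 1 0),
     Assign 6 (Add (Reg 6) (Mul (Reg 4) (Reg 4))),
     Assign 7 (Add (Reg 7) (Mul (Sub (Const 1 0) (Div (Sub (Reg 3) (Reg 2)) (Sub (Reg 3) (Reg 2))))
                                (Mul (Reg 4) (Reg 4)))),
     Assign 3 (Add (Reg 3) (Const 1 0)),
     Assign 8 (Reg 3),
     Query 8,
     Assign 8 (Sub (Mul (Add (Const 1 0) (Reg 8)) (Reg 4)) (Reg 5)),
     Assign 5 (Reg 4),
     Assign 4 (Reg 8),
     Assign 8 (Sub (Reg 0) (Reg 3)),
     Branch 8 2,
     Assign 1 (Div (Reg 7) (Reg 6)),
     Assign 0 (Const 1 0)]"

text \<open>The state at instruction 2 after \<open>k\<close> passes through the loop.\<close>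

definition loop_invariant :: "nat \<Rightarrow> (nat \<Rightarrow> real) \<Rightarrow> nat \<Rightarrow> nat \<Rightarrow> (nat \<Rightarrow> complex) \<Rightarrow> bool" where
  "loop_invariant n v j k x \<longleftrightarrow>
     x 0 = of_nat n \<and> x 2 = of_nat j \<and> x 3 = of_nat k \<and>
     x 4 = complex_of_real (eigensequence v k) \<and>
     x 5 = complex_of_real (if k = 0 then 0 else eigensequence v (k - 1)) \<and>
     x 6 = complex_of_real (partial_weight k v) \<and> x 7 = complex_of_real (weight_at k j v)"

lemma assign_step:
  "expr_val x e = z \<Longrightarrow> p < length xi_program \<Longrightarrow> q = Suc p \<Longrightarrow> y = x(i := z) \<Longrightarrow> xi_program ! p = Assign i e \<Longrightarrow>
   bss_step xi_program orc (Config p 0 0 x Q) (Config q 0 0 y Q)"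
  using bss_step.assign[of p xi_program i e orc 0 0 x Q] by simp

lemma query_step:
  "p < length xi_program \<Longrightarrow> xi_program ! p = Query i \<Longrightarrow> q = Suc p \<Longrightarrow> x i = of_nat k \<Longrightarrow> y = x(i := orc k) \<Longrightarrow>
   bss_step xi_program orc (Config p 0 0 x Q) (Config q 0 0 y (insert k Q))"
  by (simp add: bss_step.query)

text \<open>Pass \<open>k\<close> reads the information number \<open>k + 1\<close>, which is \<open>v(k)\<close>. The loop is left at instruction 12 after \<open>n + 1\<close> passes.\<close>

lemma loop_iteration:
  assumes inv: "loop_invariant n v j k x"
  obtains y where "loop_invariant n v j (Suc k) y"
    and "(bss_step xi_program (\<lambda>k. eval3 k (v, j)))\<^sup>*\<^sup>* (Config 2 0 0 x Q)
      (Config (if Suc k \<le> n then 2 else 12) 0 0 y (insert (Suc k) Q))"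
proof -
  let ?orc = "\<lambda>k. eval3 k (v, j)"
  note x = inv[unfolded loop_invariant_def]
  define x1 where "x1 = x(6 := complex_of_real (partial_weight (Suc k) v))"
  define x2 where "x2 = x1(7 := complex_of_real (weight_at (Suc k) j v))"
  define x3 where "x3 = x2(3 := of_nat (Suc k))"
  define x4 where "x4 = x3(8 := of_nat (Suc k))"
  define x5 where "x5 = x4(8 := complex_of_real (v k))"
  define x6 where "x6 = x5(8 := complex_of_real (eigensequence v (Suc k)))"
  define x7 where "x7 = x6(5 := complex_of_real (eigensequence v k))"
  define x8 where "x8 = x7(4 := complex_of_real (eigensequence v (Suc k)))"
  define x9 where "x9 = x8(8 := complex_of_real (real n - real (Suc k)))"
  note defs = x9_def x8_def x7_def x6_def x5_def x4_def x3_def x2_def x1_def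
  have "bss_step xi_program ?orc (Config 2 0 0 x Q) (Config 3 0 0 x1 Q)"
    by (rule assign_step[OF _ _ _ x1_def])
      (simp_all add: xi_program_def x1_def x partial_weight_def power2_eq_square)
  moreover have "bss_step xi_program ?orc (Config 3 0 0 x1 Q) (Config 4 0 0 x2 Q)"
    by (rule assign_step[OF _ _ _ x2_def])
      (simp_all add: xi_program_def x2_def x1_def x weight_at_def power2_eq_square complex_eq_iff)
  moreover have "bss_step xi_program ?orc (Config 4 0 0 x2 Q) (Config 5 0 0 x3 Q)"
    by (rule assign_step[OF _ _ _ x3_def]) (simp_all add: xi_program_def defs x complex_eq_iff)
  moreover have "bss_step xi_program ?orc (Config 5 0 0 x3 Q) (Config 6 0 0 x4 Q)"
    by (rule assign_step[OF _ _ _ x4_def]) (simp_all add: xi_program_def defs x)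
  moreover have "bss_step xi_program ?orc (Config 6 0 0 x4 Q) (Config 7 0 0 x5 (insert (Suc k) Q))"
    by (rule query_step[where i = 8]) (simp_all add: xi_program_def defs)
  moreover have "bss_step xi_program ?orc (Config 7 0 0 x5 (insert (Suc k) Q)) (Config 8 0 0 x6 (insert (Suc k) Q))"
    by (rule assign_step[OF _ _ _ x6_def]) (simp_all add: xi_program_def defs x eigensequence_Suc complex_eq_iff)
  moreover have "bss_step xi_program ?orc (Config 8 0 0 x6 (insert (Suc k) Q)) (Config 9 0 0 x7 (insert (Suc k) Q))"
    by (rule assign_step[OF _ _ _ x7_def]) (simp_all add: xi_program_def defs x)
  moreover have "bss_step xi_program ?orc (Config 9 0 0 x7 (insert (Suc k) Q)) (Config 10 0 0 x8 (insert (Suc k) Q))"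
    by (rule assign_step[OF _ _ _ x8_def]) (simp_all add: xi_program_def defs x)
  moreover have "bss_step xi_program ?orc (Config 10 0 0 x8 (insert (Suc k) Q)) (Config 11 0 0 x9 (insert (Suc k) Q))"
    by (rule assign_step[OF _ _ _ x9_def]) (simp_all add: xi_program_def defs x)
  moreover have "bss_step xi_program ?orc (Config 11 0 0 x9 (insert (Suc k) Q))
      (Config (if Suc k \<le> n then 2 else 12) 0 0 x9 (insert (Suc k) Q))"
  proof -
    have "(Re (x9 8) \<ge> 0) = (Suc k \<le> n)" by (auto simp: x9_def)
    then show ?thesis
      using bss_step.branch[of 11 xi_program 8 2 ?orc 0 0 x9 "insert (Suc k) Q"]
      by (cases "Suc k \<le> n") (simp_all add: xi_program_def)
  qed
  ultimately have "(bss_step xi_program ?orc)\<^sup>*\<^sup>* (Config 2 0 0 x Q)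
      (Config (if Suc k \<le> n then 2 else 12) 0 0 x9 (insert (Suc k) Q))"
    by (meson converse_rtranclp_into_rtranclp r_into_rtranclp)
  moreover have "loop_invariant n v j (Suc k) x9"
    using x by (simp add: loop_invariant_def defs)
  ultimately show thesis using that by blast
qed

lemma xi_program_computes:
  "bss_computes xi_program (\<lambda>k. eval3 k (v, j)) n [complex_of_real (xi_approx n (v, j))] {0..Suc n}"
proof -
  let ?orc = "\<lambda>k. eval3 k (v, j)"
  let ?R = "(bss_step xi_program ?orc)\<^sup>*\<^sup>*"
  define i0 :: "nat \<Rightarrow> complex" where "i0 = (\<lambda>_. 0)(0 := of_nat n)"
  have start: "?R (Config 0 0 0 i0 {}) (Config 2 0 0 (i0(2 := of_nat j, 4 := 1)) {0})"
  proof -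
    have "bss_step xi_program ?orc (Config 0 0 0 i0 {}) (Config 1 0 0 (i0(2 := of_nat j)) (insert 0 {}))"
      by (rule query_step[where i = 2]) (simp_all add: xi_program_def i0_def)
    moreover have "bss_step xi_program ?orc (Config 1 0 0 (i0(2 := of_nat j)) {0}) (Config 2 0 0 (i0(2 := of_nat j, 4 := 1)) {0})"
      by (rule assign_step[OF _ _ _ refl]) (simp_all add: xi_program_def complex_eq_iff)
    ultimately show ?thesis by (meson converse_rtranclp_into_rtranclp r_into_rtranclp)
  qed
  have loop: "\<exists>x. loop_invariant n v j k x \<and> ?R (Config 0 0 0 i0 {}) (Config 2 0 0 x {0..k})" if "k \<le> n" for k
    using that
  proof (induction k)
    case 0
    have "loop_invariant n v j 0 (i0(2 := of_nat j, 4 := 1))"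
      by (simp add: i0_def loop_invariant_def partial_weight_def weight_at_def)
    with start show ?case unfolding atLeastAtMost_singleton by blast
  next
    case (Suc k)
    then obtain x where x: "loop_invariant n v j k x" "?R (Config 0 0 0 i0 {}) (Config 2 0 0 x {0..k})" by auto
    obtain y where "loop_invariant n v j (Suc k) y" "?R (Config 2 0 0 x {0..k}) (Config 2 0 0 y (insert (Suc k) {0..k}))"
      using loop_iteration[OF x(1), of "{0..k}"] Suc.prems by auto
    with x(2) show ?case by (metis atLeast0_atMost_Suc rtranclp_trans)
  qed
  from loop[of n] obtain x where x: "loop_invariant n v j n x" "?R (Config 0 0 0 i0 {}) (Config 2 0 0 x {0..n})" by auto
  obtain y where y: "loop_invariant n v j (Suc n) y" "?R (Config 2 0 0 x {0..n}) (Config 12 0 0 y (insert (Suc n) {0..n}))"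
    using loop_iteration[OF x(1), of "{0..n}"] by auto
  define z where "z = y(1 := complex_of_real (xi_approx n (v, j)))"
  have "bss_step xi_program ?orc (Config 12 0 0 y {0..Suc n}) (Config 13 0 0 z {0..Suc n})"
    by (rule assign_step[OF _ _ _ z_def])
      (use y(1) in \<open>simp_all add: xi_program_def z_def loop_invariant_def xi_approx_def\<close>)
  moreover have "bss_step xi_program ?orc (Config 13 0 0 z {0..Suc n}) (Config (length xi_program) 0 0 (z(0 := 1)) {0..Suc n})"
    by (rule assign_step[OF _ _ _ refl]) (simp_all add: xi_program_def complex_eq_iff)
  ultimately have "?R (Config 12 0 0 y {0..Suc n}) (Config (length xi_program) 0 0 (z(0 := 1)) {0..Suc n})"
    by (meson converse_rtranclp_into_rtranclp r_into_rtranclp)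
  moreover have "?R (Config 0 0 0 i0 {}) (Config 12 0 0 y {0..Suc n})"
    using x(2) y(2) by (metis atLeast0_atMost_Suc rtranclp_trans)
  ultimately have "?R (Config 0 0 0 i0 {}) (Config (length xi_program) 0 0 (z(0 := 1)) {0..Suc n})"
    by (rule rtranclp_trans[rotated])
  then show ?thesis
    unfolding bss_computes_def i0_def by (intro exI[of _ 0] exI[of _ "z(0 := 1)"]) (simp add: z_def)
qed

lemma xi_approx_general_algorithm:
  "general_algorithm_with (bounded_potentials \<times> UNIV) {0..} (range eval3) (\<lambda>_. eval3 ` {0..Suc n}) (xi_approx n)"
  unfolding general_algorithm_with_def
proof (intro ballI conjI impI)
  fix A B :: "(nat \<Rightarrow> real) \<times> nat"
  assume agree: "\<forall>g\<in>eval3 ` {0..Suc n}. g B = g A"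
  obtain v j v' j' where AB: "A = (v, j)" "B = (v', j')" by (metis prod.exhaust)
  have "j' = j" using agree AB by (auto dest: bspec[of _ _ 0])
  moreover have "v' i = v i" if "i \<le> n" for i
  proof -
    have "eval3 (Suc i) \<in> eval3 ` {0..Suc n}" using that by (intro imageI) simp
    with agree have "eval3 (Suc i) B = eval3 (Suc i) A" by blast
    then show ?thesis by (simp add: AB)
  qed
  then have "eigensequence v' i = eigensequence v i" if "i < Suc n" for i
    using that by (intro eigensequence_cong) auto
  ultimately show "xi_approx n B = xi_approx n A"
    unfolding AB xi_approx_def weight_at_def partial_weight_def by (auto intro!: arg_cong2[of _ _ _ _ "(/)"] sum.cong)
qed (auto simp: xi_approx_nonneg)

theorem Xi_hat_in_Delta2A:
  "in_Delta2A Xi_hat (bounded_potentials \<times> UNIV) {0..} Lambda3 eval3 (\<lambda>r. [complex_of_real r])"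
proof -
  have "arithmetic_algorithms (bounded_potentials \<times> UNIV) {0..} eval3 (\<lambda>r. [complex_of_real r]) xi_approx"
    unfolding arithmetic_algorithms_def
  proof (intro exI[of _ "\<lambda>n _. eval3 ` {0..Suc n}"] exI[of _ xi_program] conjI allI ballI)
    fix n and A :: "(nat \<Rightarrow> real) \<times> nat"
    show "\<exists>K. bss_computes xi_program (\<lambda>k. eval3 k A) n [complex_of_real (xi_approx n A)] K \<and>
        eval3 ` K \<subseteq> eval3 ` {0..Suc n}"
      using xi_program_computes[of "fst A" "snd A" n] by auto
  qed (rule xi_approx_general_algorithm)
  moreover have "inj_on (\<lambda>r. [complex_of_real r]) {0..}" by (auto simp: inj_on_def)
  ultimately show ?thesis
    unfolding in_Delta2A_def using range_eval3 xi_approx_tendsto by blast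
qed

section \<open>Failure of error control\<close>

text \<open>Beyond the support the recursion is \<open>u(n+2) = u(n+1) - u(n)\<close>, and it conserves the positive definite quadratic form
\<open>q = u(n+1)\<^sup>2 - u(n+1) u(n) + u(n)\<^sup>2\<close>. If \<open>u\<close> tended to 0, then \<open>q\<close> would vanish and with it two consecutive entries
of \<open>u\<close>; running the recursion backwards, \<open>u(0)\<close> would vanish too.\<close>

lemma not_square_summable_of_finite_support:
  assumes "\<And>n. n \<ge> N \<Longrightarrow> v n = 0" shows "\<not> summable (\<lambda>n. (eigensequence v n)\<^sup>2)"
proof
  let ?u = "eigensequence v"
  assume "summable (\<lambda>n. (?u n)\<^sup>2)"
  then have "(\<lambda>n. (?u n)\<^sup>2) \<longlonglongrightarrow> 0" by (rule summable_LIMSEQ_zero)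
  then have u0: "?u \<longlonglongrightarrow> 0" by (simp add: power_tendsto_0_iff)
  \<comment> \<open>positive definite, as \<open>2 q = (a - b)\<^sup>2 + a\<^sup>2 + b\<^sup>2\<close> for consecutive entries \<open>a\<close>, \<open>b\<close>\<close>
  define q where "q n = (?u (Suc n))\<^sup>2 - ?u (Suc n) * ?u n + (?u n)\<^sup>2" for n
  have "q (N + k) = q N" for k
  proof (induction k)
    case (Suc k)
    have rec: "?u (Suc (Suc (N + k))) = ?u (Suc (N + k)) - ?u (N + k)" using assms by simp
    have "(b - a)\<^sup>2 - (b - a) * b + b\<^sup>2 = b\<^sup>2 - b * a + a\<^sup>2" for a b :: real
      by (simp add: power2_eq_square algebra_simps)
    then have "q (Suc (N + k)) = q (N + k)"
      unfolding q_def rec .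
    with Suc show ?case by simp
  qed simp
  moreover have "(\<lambda>k. q (N + k)) \<longlonglongrightarrow> 0\<^sup>2 - 0 * 0 + 0\<^sup>2"
    unfolding q_def using LIMSEQ_ignore_initial_segment[OF u0, of N] LIMSEQ_ignore_initial_segment[OF u0, of "Suc N"]
    by (intro tendsto_intros) (simp_all add: add.commute)
  ultimately have "q N = 0" by (simp add: LIMSEQ_const_iff)
  then have "?u N = 0 \<and> ?u (Suc N) = 0"
  proof -
    have "2 * q N = (?u (Suc N) - ?u N)\<^sup>2 + (?u (Suc N))\<^sup>2 + (?u N)\<^sup>2"
      unfolding q_def by (simp add: power2_eq_square algebra_simps)
    with \<open>q N = 0\<close> show ?thesis
      by (smt (verit) zero_le_power2 zero_eq_power2)
  qed
  moreover have "\<not> (?u n = 0 \<and> ?u (Suc n) = 0)" for n by (induction n) auto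
  ultimately show False by blast
qed

text \<open>With error at most \<open>1/4\<close> an algorithm must separate the values \<open>3/4\<close> and 0. But these are attained by two potentials
that agree on all the entries that the algorithm reads on the first of them.\<close>

theorem Xi_hat_not_in_Delta1G: "\<not> in_Delta1G Xi_hat (bounded_potentials \<times> UNIV) {0..} Lambda3"
proof
  assume "in_Delta1G Xi_hat (bounded_potentials \<times> UNIV) {0..} Lambda3"
  then obtain \<Gamma> L where alg: "general_algorithm_with (bounded_potentials \<times> UNIV) {0..} Lambda3 L (\<Gamma> (2::nat))"
    and err: "\<And>A. A \<in> bounded_potentials \<times> UNIV \<Longrightarrow> dist (\<Gamma> 2 A) (Xi_hat A) \<le> (1/2) ^ 2"
    unfolding in_Delta1G_def general_algorithm_def by blast
  define v where "v n = (if n = 0 then - 1/2 else 3/2 :: real)" for n :: nat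
  have v: "v \<in> bounded_potentials"
    unfolding bounded_potentials_def bounded_iff v_def by (auto intro!: exI[of _ 2])
  have u: "eigensequence v n = (1/2) ^ n" for n
    by (induction n rule: induct_nat_012) (simp_all add: v_def)
  have "(\<lambda>n. (1/4 :: real) ^ n) sums (4/3)" using geometric_sums[of "1/4 :: real"] by simp
  moreover have sq: "(eigensequence v n)\<^sup>2 = (1/4) ^ n" for n
    unfolding u by (simp add: power2_eq_square flip: power_mult_distrib)
  ultimately have summ: "summable (\<lambda>n. (eigensequence v n)\<^sup>2)"
    and total: "(\<Sum>n. (eigensequence v n)\<^sup>2) = 4/3"
    by (simp_all add: sums_iff)
  have Xi_v: "Xi_hat (v, 0) = 3/4" by (simp add: Xi_hat_square_summable[OF v summ] total)
  have L: "finite (L (v, 0))" "L (v, 0) \<subseteq> range eval3"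
    and determined: "\<And>B. B \<in> bounded_potentials \<times> UNIV \<Longrightarrow> (\<forall>g\<in>L (v, 0). g B = g (v, 0)) \<Longrightarrow> \<Gamma> 2 B = \<Gamma> 2 (v, 0)"
    using alg v unfolding general_algorithm_with_def range_eval3 by blast+
  obtain K where K: "finite K" "L (v, 0) = eval3 ` K" using finite_subset_image[OF L] by auto
  then obtain N where N: "\<And>k. k \<in> K \<Longrightarrow> k \<le> N" using finite_nat_set_iff_bounded_le by meson
  define v' where "v' n = (if n < N then v n else 0)" for n
  have v': "v' \<in> bounded_potentials"
    unfolding bounded_potentials_def bounded_iff v'_def v_def by (auto intro!: exI[of _ 2])
  have "\<forall>g\<in>L (v, 0). g (v', 0) = g (v, 0)"
  proof
    fix g assume "g \<in> L (v, 0)"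
    then obtain k where "g = eval3 k" "k \<le> N" using K N by blast
    then show "g (v', 0) = g (v, 0)" by (cases k) (auto simp: v'_def)
  qed
  then have "\<Gamma> 2 (v', 0) = \<Gamma> 2 (v, 0)" using v' by (intro determined) auto
  moreover have "Xi_hat (v', 0) = 0"
    by (intro Xi_hat_not_square_summable v' not_square_summable_of_finite_support[of N]) (simp add: v'_def)
  ultimately show False
    using err[of "(v, 0)"] err[of "(v', 0)"] v v' Xi_v by (auto simp: dist_real_def power2_eq_square)
qed

theorem theorem5p2:
  shows "Xi_hat \<in> bounded_potentials \<times> (UNIV :: nat set) \<rightarrow> {0..} \<and>
    in_Delta2A Xi_hat (bounded_potentials \<times> UNIV) {0..} Lambda3 eval3 (\<lambda>r. [complex_of_real r]) \<and>
    \<not> in_Delta1G Xi_hat (bounded_potentials \<times> UNIV) {0..} Lambda3"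
  using Xi_hat_nonneg Xi_hat_in_Delta2A Xi_hat_not_in_Delta1G by auto

end
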